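(* For every integer $n\geq 1$, \[ \tilde k_{2n}(q) = \sum_{\sigma \in \mathcal{M}^c(2n)} T_{G(\sigma)}(1,q). \] In particular, $\tilde k_{2n}(q)$ is a polynomial in $q$ with nonnegative integer coefficients.
   Context: Let $q$ be a formal variable and $[i]_q=\frac{1-q^i}{1-q}=1+q+\dots+q^{i-1}$. The moments $m_n(q)$ ($n\ge 0$) of the $q$-semicircular law are defined by the formal continued fraction \[\sum_{n\ge0} m_n(q)z^n = \cfrac{1}{1-\cfrac{[1]_q z^2}{1-\cfrac{[2]_q z^2}{1-\ddots}}}\] (so $m_{n}(q)=0$ for $n$ odd). The cumulants $k_n(q)$, $n\ge1$, are defined by the formal power series identity $\sum_{n\ge1} k_n(q)\frac{z^n}{n!}=\log\big(\sum_{n\ge0} m_n(q)\frac{z^n}{n!}\big)$, and $\tilde k_{2n}(q)=k_{2n}(q)/(q-1)^{n-1}$. A matching of $\{1,\dots,2n\}$ is a set partition all of whose blocks (called arches) have size $2$; $\mathcal{M}(2n)$ denotes the set of these. A matching $\sigma$ is connected if no proper nonempty interval $\{1,\dots,j\}$, more precisely no proper subinterval of $\{1,\dots,2n\}$, is a union of blocks of $\sigma$; $\mathcal{M}^c(2n)$ denotes the set of connected matchings. The crossing graph $G(\sigma)$ of a matching $\sigma$ has vertex set the set of arches of $\sigma$, with an edge between arches $\{i,j\}$ and $\{k,\ell\}$ if and only if $i<k<j<\ell$ (the arches cross). $T_G(x,y)$ denotes the Tutte polynomial of a graph $G$. *)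

theory Defs
  imports
    "HOL-Computational_Algebra.Computational_Algebra"
    "HOL-Library.Disjoint_Sets"
begin

subsection \<open>The $q$-semicircular law\<close>

type_synonym ratfun = "rat poly fract"

definition q :: ratfun where
  "q = to_fract [:0, 1:]"

definition q_int :: "nat \<Rightarrow> ratfun" where
  "q_int i = (1 - q ^ i) / (1 - q)"

text \<open>
  \<^term>\<open>s_frac_tail a N k\<close> is the finite continued fraction
  $1/(1 - a_k z^2/(1 - a_{k+1} z^2/(\cdots/(1 - a_{k+N-1} z^2))))$.
\<close>
fun s_frac_tail :: "(nat \<Rightarrow> 'a::field) \<Rightarrow> nat \<Rightarrow> nat \<Rightarrow> 'a fps" where
  "s_frac_tail a 0 k = 1"
| "s_frac_tail a (Suc N) k =
     inverse (1 - fps_const (a k) * fps_X ^ 2 * s_frac_tail a N (Suc k))"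

text \<open>
  The infinite continued fraction is the limit of the finite ones in the usual (\<open>X\<close>-adic)
  topology on formal power series; it always exists, see \<open>s_frac_tail_tendsto\<close> below.
\<close>
definition s_frac :: "(nat \<Rightarrow> 'a::field) \<Rightarrow> 'a fps" where
  "s_frac a = lim (\<lambda>N. s_frac_tail a N 1)"

definition moment :: "nat \<Rightarrow> ratfun" where
  "moment n = fps_nth (s_frac q_int) n"

text \<open>
  \<^term>\<open>fps_ln 1\<close> is the series of $\log(1+z)$; meaningful for \<open>F\<close> with constant coefficient 1.
\<close>
definition fps_log :: "'a::field_char_0 fps \<Rightarrow> 'a fps" where
  "fps_log F = fps_compose (fps_ln 1) (F - 1)"

definition cumulant :: "nat \<Rightarrow> ratfun" where
  "cumulant n = fact n * fps_nth (fps_log (Abs_fps (\<lambda>j. moment j / fact j))) n"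

definition ktilde :: "nat \<Rightarrow> ratfun" where
  "ktilde n = cumulant (2 * n) / (q - 1) ^ (n - 1)"  \<comment> \<open>used for \<open>n \<ge> 1\<close> only\<close>


subsection \<open>Matchings and their crossing graphs\<close>

definition matchings :: "nat \<Rightarrow> nat set set set" where
  "matchings n = {\<sigma>. partition_on {1..2 * n} \<sigma> \<and> (\<forall>b\<in>\<sigma>. card b = 2)}"

definition connected_matchings :: "nat \<Rightarrow> nat set set set" where
  "connected_matchings n = {\<sigma> \<in> matchings n.
     \<not> (\<exists>i j. 1 \<le> i \<and> i \<le> j \<and> j \<le> 2 * n \<and> {i..j} \<noteq> {1..2 * n} \<and>
            (\<exists>B\<subseteq>\<sigma>. \<Union>B = {i..j}))}"

definition crosses :: "nat set \<Rightarrow> nat set \<Rightarrow> bool" where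
  "crosses a b \<longleftrightarrow> (\<exists>i j k l. a = {i, j} \<and> b = {k, l} \<and> i < k \<and> k < j \<and> j < l)"

text \<open>
  A finite simple graph is given by its vertex set and its set of edges, each edge being a
  two-element set of vertices. The vertex set of the crossing graph of \<open>\<sigma>\<close> is \<open>\<sigma>\<close> itself.
\<close>
definition crossing_edges :: "nat set set \<Rightarrow> nat set set set" where
  "crossing_edges \<sigma> = {{a, b} | a b. a \<in> \<sigma> \<and> b \<in> \<sigma> \<and> crosses a b}"


subsection \<open>The Tutte polynomial\<close>

definition components :: "'v set \<Rightarrow> 'v set set \<Rightarrow> 'v set set" where
  "components V A = V // ({(u, v). {u, v} \<in> A}\<^sup>* \<inter> V \<times> V)"

text \<open>
  The value at \<open>(x, y)\<close> of the Tutte polynomial of the graph \<open>(V, E)\<close>, by Whitney's rank generating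
  expansion. The subtractions of natural numbers are exact: a spanning subgraph \<open>(V, A)\<close> has at
  least as many components as \<open>(V, E)\<close>, and at least \<open>card V - card A\<close> of them.
  Note \<open>0 ^ 0 = 1\<close>, so that for \<open>x = 1\<close> exactly the \<open>A\<close> with as many components as \<open>E\<close> contribute.
\<close>
definition tutte :: "'v set \<Rightarrow> 'v set set \<Rightarrow> 'a::comm_ring_1 \<Rightarrow> 'a \<Rightarrow> 'a" where
  "tutte V E x y =
     (\<Sum>A\<in>Pow E. (x - 1) ^ (card (components V A) - card (components V E)) *
                 (y - 1) ^ (card (components V A) + card A - card V))"


subsection \<open>Convergence of the continued fraction\<close>

lemma s_frac_tail_nth_0: "fps_nth (s_frac_tail a N k) 0 = 1"
  by (cases N) simp_all

lemma s_frac_tail_diff_dvd: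
  "N \<le> M \<Longrightarrow> fps_X ^ (2 * N) dvd s_frac_tail a M k - s_frac_tail a N k"
proof (induction N arbitrary: M k)
  case 0
  then show ?case by simp
next
  case (Suc N)
  then obtain M' where M: "M = Suc M'" and le: "N \<le> M'"
    by (cases M) auto
  define f where "f = 1 - fps_const (a k) * fps_X ^ 2 * s_frac_tail a M' (Suc k)"
  define g where "g = 1 - fps_const (a k) * fps_X ^ 2 * s_frac_tail a N (Suc k)"
  have nz: "fps_nth f 0 \<noteq> 0" "fps_nth g 0 \<noteq> 0"
    by (simp_all add: f_def g_def)
  have "inverse f - inverse g = inverse f * inverse g * (g - f)"
    using inverse_mult_eq_1[OF nz(1)] inverse_mult_eq_1[OF nz(2)]
    by (simp add: algebra_simps)
  also have "g - f = fps_X ^ 2 * (s_frac_tail a M' (Suc k) - s_frac_tail a N (Suc k)) * fps_const (a k)"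
    by (simp add: f_def g_def algebra_simps)
  finally have eq: "inverse f - inverse g =
      fps_X ^ 2 * (s_frac_tail a M' (Suc k) - s_frac_tail a N (Suc k)) *
      (fps_const (a k) * inverse f * inverse g)"
    by (simp add: mult_ac)
  have "fps_X ^ 2 * fps_X ^ (2 * N) dvd
      fps_X ^ 2 * (s_frac_tail a M' (Suc k) - s_frac_tail a N (Suc k))"
    by (intro mult_dvd_mono Suc.IH le dvd_refl)
  then have "fps_X ^ (2 * Suc N) dvd inverse f - inverse g"
    unfolding eq power_add[symmetric] mult_Suc_right by (rule dvd_mult2)
  then show ?case
    by (simp add: M f_def g_def)
qed

lemma s_frac_tail_nth_eq:
  assumes "N \<le> M" "m < 2 * N"
  shows "fps_nth (s_frac_tail a M k) m = fps_nth (s_frac_tail a N k) m"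
proof -
  obtain h where "s_frac_tail a M k - s_frac_tail a N k = fps_X ^ (2 * N) * h"
    using s_frac_tail_diff_dvd[OF assms(1)] unfolding dvd_def by blast
  then have "fps_nth (s_frac_tail a M k - s_frac_tail a N k) m = 0"
    using assms(2) by (simp add: fps_X_power_mult_nth)
  then show ?thesis by simp
qed

lemma s_frac_tail_tendsto:
  "(\<lambda>N. s_frac_tail a N 1) \<longlonglongrightarrow> s_frac a"
proof -
  have "(\<lambda>N. s_frac_tail a N 1) \<longlonglongrightarrow> Abs_fps (\<lambda>m. fps_nth (s_frac_tail a (Suc m) 1) m)"
  proof (rule tendsto_fpsI)
    fix m
    show "\<forall>\<^sub>F N in sequentially. fps_nth (s_frac_tail a N 1) m =
        fps_nth (Abs_fps (\<lambda>m. fps_nth (s_frac_tail a (Suc m) 1) m)) m"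
      unfolding fps_nth_Abs_fps
      by (rule eventually_sequentiallyI[of "Suc m"], rule s_frac_tail_nth_eq) auto
  qed
  then show ?thesis
    unfolding s_frac_def by (simp add: limI)
qed

end

theory Submission
  imports Defs
begin

text \<open>
  By the continued fraction, \<open>m\<^sub>2\<^sub>n(q)\<close> is the sum of \<open>q\<close> to the number of crossings over all matchings.
  Expanding \<open>q = 1 + (q - 1)\<close> at each crossing turns this into the sum of \<open>(q - 1)\<close> to the size of \<open>A\<close>
  over all pairs \<open>(\<sigma>, A)\<close> of a matching and a set \<open>A\<close> of edges of its crossing graph. Such a pair is a set
  partition of the points into the supports of the components of \<open>(\<sigma>, A)\<close>, so by the exponential formula the
  cumulant is the same sum restricted to the pairs with \<open>(\<sigma>, A)\<close> connected. For fixed \<open>\<sigma>\<close> this is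
  \<open>(q - 1)\<^bsup>n - 1\<^esup> T(1, q)\<close> if the crossing graph is connected, and \<open>0\<close> otherwise. The coefficients of
  \<open>T(1, q)\<close> are nonnegative because removing a vertex of a connected graph gives a recurrence with
  nonnegative terms.
\<close>

subsection \<open>Connected spanning subgraphs\<close>

text \<open>The Whitney expansion at \<open>(1, q)\<close> is written in powers of
  \<open>q - 1\<close>, which hides positivity, and contracting edges would leave the simple graphs
  in which an edge is a two-element set. Removing a vertex \<open>r\<close> stays within them: it
  splits the vertices into two smaller sets and produces one factor \<open>y ^ d - 1\<close>, a
  multiple of \<open>y - 1\<close>. Exactly |V| - 1 factors \<open>y - 1\<close> accumulate, which
  is the normalisation in \<open>ktilde\<close>. Set partitions are never handled explicitly. The
  identities are rooted: a marked point or arch is fixed and only its component is split off. Such a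
  convolution determines its unknown by induction on the set, because the whole set occurs with
  coefficient 1. This gives both the vertex recurrence and the comparison of connected sums with
  cumulants.\<close>

definition reach :: "'v set set \<Rightarrow> 'v \<Rightarrow> 'v set" where
  "reach A v = {(u, w). {u, w} \<in> A}\<^sup>* `` {v}"

lemma reach_refl [simp]: "v \<in> reach A v"
  by (simp add: reach_def)

lemma reach_step: "u \<in> reach A v \<Longrightarrow> {u, w} \<in> A \<Longrightarrow> w \<in> reach A v"
  by (auto simp: reach_def intro: rtrancl_into_rtrancl)

lemma reach_induct [consumes 1, case_names refl step]:
  assumes "w \<in> reach A v" "P v"
    and "\<And>u w. u \<in> reach A v \<Longrightarrow> P u \<Longrightarrow> {u, w} \<in> A \<Longrightarrow> P w"
  shows "P w"
proof -
  have "(v, w) \<in> {(u, w). {u, w} \<in> A}\<^sup>*"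
    using assms(1) by (simp add: reach_def)
  then show ?thesis
    by (induction rule: rtrancl_induct) (use assms(2,3) in \<open>auto simp: reach_def\<close>)
qed

lemma reach_subset: "A \<subseteq> Pow V \<Longrightarrow> v \<in> V \<Longrightarrow> reach A v \<subseteq> V"
proof
  fix w assume "A \<subseteq> Pow V" "v \<in> V" "w \<in> reach A v"
  from this(3) show "w \<in> V"
    by (induction rule: reach_induct) (use \<open>A \<subseteq> Pow V\<close> \<open>v \<in> V\<close> in auto)
qed

lemma reach_mono: "A \<subseteq> B \<Longrightarrow> reach A v \<subseteq> reach B v"
  unfolding reach_def by (intro Image_mono rtrancl_mono) auto

lemma reach_commute: "w \<in> reach A v \<Longrightarrow> v \<in> reach A w"
proof -
  have "sym ({(u, w). {u, w} \<in> A}\<^sup>*)"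
    by (intro sym_rtrancl symI) (auto simp: insert_commute)
  then show "w \<in> reach A v \<Longrightarrow> v \<in> reach A w"
    by (auto simp: reach_def dest: symD)
qed

lemma reach_trans: "w \<in> reach A v \<Longrightarrow> x \<in> reach A w \<Longrightarrow> x \<in> reach A v"
  by (auto simp: reach_def)

lemma reach_eq: "w \<in> reach A v \<Longrightarrow> reach A w = reach A v"
  by (intro equalityI subsetI) (auto intro: reach_trans dest: reach_commute)

text \<open>Restricting the relation to \<open>V \<times> V\<close> in \<open>components\<close> is
  harmless: edges inside \<open>V\<close> never lead out of it.\<close>

lemma components_eq_reach:
  assumes "A \<subseteq> Pow V"
  shows "components V A = reach A ` V"
proof -
  have "({(u, w). {u, w} \<in> A}\<^sup>* \<inter> V \<times> V) `` {v} = reach A v" if "v \<in> V" for v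
    using that reach_subset[OF assms that] by (auto simp: reach_def)
  then show ?thesis
    by (auto simp: components_def quotient_def)
qed

lemma card_components_eq_1_iff:
  assumes "A \<subseteq> Pow V" "v \<in> V"
  shows "card (components V A) = 1 \<longleftrightarrow> reach A v = V"
proof
  assume "card (components V A) = 1"
  then obtain C where "reach A ` V = {C}"
    unfolding components_eq_reach[OF assms(1)] by (auto simp: card_1_singleton_iff)
  then have "w \<in> reach A v" if "w \<in> V" for w
    using that assms(2) reach_refl[of w A] by (metis imageI singletonD)
  then show "reach A v = V"
    using reach_subset[OF assms] by auto
next
  assume *: "reach A v = V"
  then have "reach A ` V = (\<lambda>_. V) ` V"
    by (intro image_cong refl) (metis reach_eq)
  then show "card (components V A) = 1"
    using assms(2) unfolding components_eq_reach[OF assms(1)] by (auto simp: image_constant_conv)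
qed

lemma reach_induced: "reach (A \<inter> Pow (reach A v)) v = reach A v"
proof
  show "reach (A \<inter> Pow (reach A v)) v \<subseteq> reach A v"
    by (rule reach_mono) auto
  show "reach A v \<subseteq> reach (A \<inter> Pow (reach A v)) v"
  proof
    fix w assume "w \<in> reach A v"
    then show "w \<in> reach (A \<inter> Pow (reach A v)) v"
    proof (induction rule: reach_induct)
      case (step u w)
      moreover have "w \<in> reach A v"
        using step reach_step by metis
      ultimately show ?case
        by (simp add: reach_step[of u])
    qed simp
  qed
qed

lemma edges_split_reach:
  assumes "A \<subseteq> Pow V" "\<And>e. e \<in> A \<Longrightarrow> card e = 2"
  shows "A = A \<inter> Pow (reach A v) \<union> A \<inter> Pow (V - reach A v)"
proof -
  have "e \<subseteq> reach A v \<or> e \<subseteq> V - reach A v" if "e \<in> A" for e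
  proof -
    obtain x y where e: "e = {x, y}"
      using assms(2)[OF \<open>e \<in> A\<close>] by (auto simp: card_2_iff)
    then have "x \<in> reach A v \<longleftrightarrow> y \<in> reach A v"
      using that reach_step[of x A v y] reach_step[of y A v x] by (auto simp: insert_commute)
    then show ?thesis
      using that e assms(1) by auto
  qed
  then show ?thesis by auto
qed

lemma reach_union_separated:
  assumes "A \<subseteq> Pow T" "B \<subseteq> Pow (- T)" "v \<in> T"
  shows "reach (A \<union> B) v = reach A v"
proof
  show "reach A v \<subseteq> reach (A \<union> B) v"
    by (rule reach_mono) simp
  show "reach (A \<union> B) v \<subseteq> reach A v"
  proof
    fix w assume "w \<in> reach (A \<union> B) v"
    then show "w \<in> reach A v"
    proof (induction rule: reach_induct)
      case (step u w)
      then have "u \<in> T"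
        using reach_subset[OF assms(1,3)] by auto
      then have "{u, w} \<in> A"
        using step assms(2) by auto
      then show ?case
        using step reach_step by metis
    qed simp
  qed
qed

lemma disjoint_Pow_Diff:
  assumes "{} \<notin> A" "A \<subseteq> Pow T"
  shows "A \<inter> Pow (V - T) = {}"
proof (rule equals0I)
  fix x assume "x \<in> A \<inter> Pow (V - T)"
  then have "x \<subseteq> T \<inter> (V - T)" "x \<noteq> {}"
    using assms by auto
  then show False by simp
qed

lemma disjoint_Pow_Diff':
  assumes "{} \<notin> B" "B \<subseteq> Pow (V - T)"
  shows "B \<inter> Pow T = {}"
proof (rule equals0I)
  fix x assume "x \<in> B \<inter> Pow T"
  then have "x \<subseteq> T \<inter> (V - T)" "x \<noteq> {}"
    using assms by auto
  then show False by simp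
qed

text \<open>\<open>E\<close> is an ambient edge set that may be larger than the graph at hand;
  cutting it down by \<open>Pow V\<close> gives the induced subgraph for every \<open>V\<close>. The
  empty graph has no component, so its sum is 0.\<close>

definition conn_sum :: "'a::comm_ring_1 \<Rightarrow> 'v set set \<Rightarrow> 'v set \<Rightarrow> 'a" where
  "conn_sum t E V = (\<Sum>A | A \<subseteq> E \<inter> Pow V \<and> card (components V A) = 1. t ^ card A)"

lemma sum_power_card_Pow:
  fixes t :: "'a::comm_ring_1"
  assumes "finite A"
  shows "(\<Sum>B\<in>Pow A. t ^ card B) = (1 + t) ^ card A"
proof -
  have "(1 + t) ^ card A = (\<Prod>x\<in>A. t + 1)"
    by (simp add: add.commute)
  also have "\<dots> = (\<Sum>B\<in>Pow A. t ^ card B)"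
    using assms by (subst prod_add) auto
  finally show ?thesis by simp
qed

text \<open>A spanning subgraph splits into the component of \<open>v\<close> and an arbitrary subgraph of the rest.\<close>

lemma power_card_eq_sum_conn_sum:
  fixes t :: "'a::comm_ring_1"
  assumes "finite V" "v \<in> V" and E: "\<And>e. e \<in> E \<Longrightarrow> card e = 2"
  shows "(1 + t) ^ card (E \<inter> Pow V) =
    (\<Sum>T | v \<in> T \<and> T \<subseteq> V. conn_sum t E T * (1 + t) ^ card (E \<inter> Pow (V - T)))"
proof -
  have fin: "finite (E \<inter> Pow T)" if "T \<subseteq> V" for T
    using finite_subset[OF that assms(1)] by simp
  let ?\<T> = "{T. v \<in> T \<and> T \<subseteq> V}"
  have "(1 + t) ^ card (E \<inter> Pow V) = (\<Sum>A\<in>Pow (E \<inter> Pow V). t ^ card A)"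
    using fin by (intro sum_power_card_Pow[symmetric]) simp
  also have "\<dots> = (\<Sum>T\<in>?\<T>. \<Sum>A | A \<in> Pow (E \<inter> Pow V) \<and> reach A v = T. t ^ card A)"
  proof (rule sum.group[symmetric])
    show "(\<lambda>A. reach A v) ` Pow (E \<inter> Pow V) \<subseteq> ?\<T>"
      using reach_subset[of _ V v] assms(2) by auto
  qed (use assms(1) fin in simp_all)
  also have "\<dots> = (\<Sum>T\<in>?\<T>. conn_sum t E T * (1 + t) ^ card (E \<inter> Pow (V - T)))"
  proof (intro sum.cong refl, clarify)
    fix T assume T: "v \<in> T" "T \<subseteq> V"
    have "(\<Sum>A | A \<in> Pow (E \<inter> Pow V) \<and> reach A v = T. t ^ card A) =
        (\<Sum>(A, B)\<in>{A. A \<subseteq> E \<inter> Pow T \<and> card (components T A) = 1} \<times> Pow (E \<inter> Pow (V - T)).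
           t ^ card A * t ^ card B)"
    proof (rule sum.reindex_bij_witness[where i = "\<lambda>(A, B). A \<union> B"
            and j = "\<lambda>A. (A \<inter> Pow T, A \<inter> Pow (V - T))"])
      fix A assume A: "A \<in> {A. A \<in> Pow (E \<inter> Pow V) \<and> reach A v = T}"
      then have A': "A \<inter> Pow T \<union> A \<inter> Pow (V - T) = A"
        using edges_split_reach[of A V v] by (auto simp: E subset_iff)
      then show "(case (A \<inter> Pow T, A \<inter> Pow (V - T)) of (A, B) \<Rightarrow> A \<union> B) = A"
        by simp
      have "reach (A \<inter> Pow T) v = T"
        using A reach_induced[of A v] by auto
      then show "(A \<inter> Pow T, A \<inter> Pow (V - T)) \<in>
          {A. A \<subseteq> E \<inter> Pow T \<and> card (components T A) = 1} \<times> Pow (E \<inter> Pow (V - T))"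
        using A card_components_eq_1_iff[of "A \<inter> Pow T" T v] T by auto
      \<comment> \<open>The empty set would belong to both power sets; not being an edge, it cannot
        spoil disjointness.\<close>
      have "{} \<notin> A"
        using A E[of "{}"] by auto
      then have "(A \<inter> Pow T) \<inter> (A \<inter> Pow (V - T)) = {}"
        using disjoint_Pow_Diff[of "A \<inter> Pow T" T V] by (simp add: Int_ac)
      then have "card (A \<inter> Pow T) + card (A \<inter> Pow (V - T)) = card A"
        using A finite_subset[of A "E \<inter> Pow V"] fin
        by (subst card_Un_disjoint[symmetric]) (simp_all add: A')
      then show "(case (A \<inter> Pow T, A \<inter> Pow (V - T)) of (A, B) \<Rightarrow> t ^ card A * t ^ card B) =
          t ^ card A"
        by (simp flip: power_add)
    next
      fix P assume "P \<in> {A. A \<subseteq> E \<inter> Pow T \<and> card (components T A) = 1} \<times> Pow (E \<inter> Pow (V - T))"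
      then obtain A B where P: "P = (A, B)" and A: "A \<subseteq> E \<inter> Pow T" "reach A v = T"
        and B: "B \<subseteq> E \<inter> Pow (V - T)"
        using card_components_eq_1_iff[of _ T v] T by auto
      have "{} \<notin> A" "{} \<notin> B"
        using A B E[of "{}"] by auto
      then have "B \<inter> Pow T = {}" "A \<inter> Pow (V - T) = {}"
        using disjoint_Pow_Diff'[of B V T] disjoint_Pow_Diff[of A T V] A(1) B by simp_all
      moreover have "A \<inter> Pow T = A" "B \<inter> Pow (V - T) = B"
        using A(1) B by auto
      ultimately have "(A \<union> B) \<inter> Pow T = A" "(A \<union> B) \<inter> Pow (V - T) = B"
        by (simp_all add: Int_Un_distrib2)
      then show "(\<lambda>A. (A \<inter> Pow T, A \<inter> Pow (V - T))) (case P of (A, B) \<Rightarrow> A \<union> B) = P"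
        by (simp add: P)
      have "reach (A \<union> B) v = T"
      proof -
        have "Pow (V - T) \<subseteq> Pow (- T)"
          by auto
        then have "B \<subseteq> Pow (- T)"
          using B by (meson Int_subset_iff subset_trans)
        then show ?thesis
          using reach_union_separated[of A T B v] A T by simp
      qed
      then show "(case P of (A, B) \<Rightarrow> A \<union> B) \<in> {A. A \<in> Pow (E \<inter> Pow V) \<and> reach A v = T}"
        using A B T P by (auto simp: subset_iff)
    qed
    also have "\<dots> = conn_sum t E T * (\<Sum>B\<in>Pow (E \<inter> Pow (V - T)). t ^ card B)"
      by (simp add: conn_sum_def sum_product sum.cartesian_product)
    also have "\<dots> = conn_sum t E T * (1 + t) ^ card (E \<inter> Pow (V - T))"
      using fin by (subst sum_power_card_Pow) simp_all
    finally show "(\<Sum>A | A \<in> Pow (E \<inter> Pow V) \<and> reach A v = T. t ^ card A) =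
        conn_sum t E T * (1 + t) ^ card (E \<inter> Pow (V - T))" .
  qed
  finally show ?thesis .
qed

text \<open>Grow a vertex set from \<open>v\<close> one vertex at a time: while it is not all of
  \<open>V\<close>, connectedness supplies an edge leaving it, and that edge is new inside the
  enlarged set. The bound makes the truncated exponents of \<open>tutte\<close> exact.\<close>

lemma card_le_edges_connected:
  assumes "finite V" "finite A" "v \<in> V" and V: "reach A v = V"
  shows "card V \<le> card A + 1"
proof -
  have "\<exists>U\<subseteq>V. v \<in> U \<and> card U = Suc k \<and> k \<le> card (A \<inter> Pow U)" if "Suc k \<le> card V" for k
    using that
  proof (induction k)
    case 0
    then show ?case using assms(3) by (intro exI[of _ "{v}"]) auto
  next
    case (Suc k)
    then obtain U where U: "U \<subseteq> V" "v \<in> U" "card U = Suc k" "k \<le> card (A \<inter> Pow U)"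
      by auto
    have "\<exists>x\<in>U. \<exists>y\<in>V - U. {x, y} \<in> A"
    proof (rule ccontr)
      assume *: "\<not> (\<exists>x\<in>U. \<exists>y\<in>V - U. {x, y} \<in> A)"
      have "w \<in> U" if "w \<in> reach A v" for w
        using that
      proof (induction rule: reach_induct)
        case (step u w)
        then have "w \<in> V"
          using V reach_step by metis
        then show ?case
          using * step by auto
      qed (fact U)
      then show False
        using U V Suc.prems by (metis Suc_n_not_le_n subsetI subset_antisym)
    qed
    then obtain x y where xy: "x \<in> U" "y \<in> V" "y \<notin> U" "{x, y} \<in> A"
      by auto
    have "A \<inter> Pow U \<subseteq> A \<inter> Pow (insert y U)"
      by blast
    moreover have "A \<inter> Pow U \<noteq> A \<inter> Pow (insert y U)"
    proof -
      have "{x, y} \<in> A \<inter> Pow (insert y U)" "{x, y} \<notin> A \<inter> Pow U"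
        using xy by simp_all
      then show ?thesis by metis
    qed
    ultimately have "card (A \<inter> Pow U) < card (A \<inter> Pow (insert y U))"
      by (metis assms(2) finite_Int psubset_card_mono psubsetI)
    moreover have "card (insert y U) = Suc (Suc k)"
      using U xy finite_subset[OF U(1) assms(1)] by simp
    ultimately have "insert y U \<subseteq> V \<and> v \<in> insert y U \<and> card (insert y U) = Suc (Suc k) \<and>
        Suc k \<le> card (A \<inter> Pow (insert y U))"
      using U xy by simp
    then show ?case ..
  qed
  from this[of "card V - 1"] obtain U where "card V - 1 \<le> card (A \<inter> Pow U)"
    using assms(1,3) by (cases "card V") auto
  also have "\<dots> \<le> card A"
    using assms(2) by (intro card_mono) auto
  finally show ?thesis by simp
qed

section \<open>Removing a vertex from a connected graph\<close>

lemma card_edges_insert: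
  assumes "finite S" "r \<notin> S" and E: "\<And>e. e \<in> E \<Longrightarrow> card e = 2"
  shows "card (E \<inter> Pow (insert r S)) = card {x \<in> S. {r, x} \<in> E} + card (E \<inter> Pow S)"
proof -
  have "E \<inter> Pow (insert r S) = (\<lambda>x. {r, x}) ` {x \<in> S. {r, x} \<in> E} \<union> E \<inter> Pow S"
  proof (intro equalityI subsetI)
    fix e assume e: "e \<in> E \<inter> Pow (insert r S)"
    then obtain x y where xy: "e = {x, y}" "x \<noteq> y"
      using E[of e] by (auto simp: card_2_iff)
    then consider "x = r" | "y = r" | "r \<notin> e"
      by auto
    then show "e \<in> (\<lambda>x. {r, x}) ` {x \<in> S. {r, x} \<in> E} \<union> E \<inter> Pow S"
      by cases (use e xy in \<open>auto simp: insert_commute\<close>)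
  qed auto
  moreover have "(\<lambda>x. {r, x}) ` {x \<in> S. {r, x} \<in> E} \<inter> (E \<inter> Pow S) = {}"
    using assms(2) by auto
  moreover have "inj_on (\<lambda>x. {r, x}) {x \<in> S. {r, x} \<in> E}"
    by (auto simp: inj_on_def doubleton_eq_iff)
  ultimately show ?thesis
    using assms(1) by (simp add: card_Un_disjoint card_image)
qed

text \<open>\<open>g\<close> is the right side of the recurrence below, which is only claimed for
  sets containing \<open>u\<close>. Checking it after convolution with the unrestricted sum
  \<open>Z\<close> replaces a bijection on connected graphs by component splittings at
  \<open>r\<close> and at \<open>u\<close>.\<close>

lemma conn_sum_recurrence_convolved:
  fixes t :: "'a::comm_ring_1"
  assumes "finite V" "r \<in> V" "u \<in> V" "r \<noteq> u" and E: "\<And>e. e \<in> E \<Longrightarrow> card e = 2"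
  defines "d \<equiv> \<lambda>S. card {x \<in> S. {r, x} \<in> E}"
  defines "Z \<equiv> \<lambda>V. (1 + t) ^ card (E \<inter> Pow V)"
  defines "g \<equiv> \<lambda>V. \<Sum>S | u \<in> S \<and> S \<subseteq> V - {r}.
       ((1 + t) ^ d S - 1) * conn_sum t E S * conn_sum t E (V - S)"
  shows "(\<Sum>T | r \<in> T \<and> T \<subseteq> V. (if u \<in> T then g T else conn_sum t E T) * Z (V - T)) = Z V"
proof -
  let ?c = "conn_sum t E"
  have Z: "(\<Sum>T | v \<in> T \<and> T \<subseteq> W. ?c T * Z (W - T)) = Z W" if "W \<subseteq> V" "v \<in> W" for v W
    unfolding Z_def
    using that power_card_eq_sum_conn_sum[OF finite_subset[OF that(1) assms(1)] that(2) E, where t = t] by simp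
  have fin: "finite {S. P S \<and> S \<subseteq> W}" if "W \<subseteq> V" for P W
    using finite_subset[OF that assms(1)] by simp
  have split: "{T. r \<in> T \<and> T \<subseteq> V} = {T. (r \<in> T \<and> u \<in> T) \<and> T \<subseteq> V} \<union> {T. (r \<in> T \<and> u \<notin> T) \<and> T \<subseteq> V}"
    by auto
  have *: "{S. u \<in> S \<and> S \<subseteq> T - {r}} = {S. (u \<in> S \<and> r \<notin> S) \<and> S \<subseteq> T}" for T
    by auto
  let ?\<S> = "{S. u \<in> S \<and> S \<subseteq> V - {r}}"
  have "(\<Sum>T | (r \<in> T \<and> u \<in> T) \<and> T \<subseteq> V. g T * Z (V - T)) =
      (\<Sum>T | (r \<in> T \<and> u \<in> T) \<and> T \<subseteq> V. \<Sum>S | u \<in> S \<and> S \<subseteq> T - {r}.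
        ((1 + t) ^ d S - 1) * ?c S * ?c (T - S) * Z (V - T))"
    by (simp add: g_def sum_distrib_right)
  also have "\<dots> = (\<Sum>(T, S)\<in>(SIGMA T:{T. (r \<in> T \<and> u \<in> T) \<and> T \<subseteq> V}. {S. u \<in> S \<and> S \<subseteq> T - {r}}).
        ((1 + t) ^ d S - 1) * ?c S * ?c (T - S) * Z (V - T))"
    unfolding * by (rule sum.Sigma) (use fin in auto)
  \<comment> \<open>With \<open>S\<close> fixed, \<open>R = T - S\<close> runs over the sets
    containing \<open>r\<close>; summing over \<open>R\<close> rebuilds
    \<open>Z (V - S)\<close>.\<close>
  also have "\<dots> = (\<Sum>(S, R)\<in>(SIGMA S:?\<S>. {R. r \<in> R \<and> R \<subseteq> V - S}).
        ((1 + t) ^ d S - 1) * ?c S * (?c R * Z (V - S - R)))"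
  proof (rule sum.reindex_bij_witness[where i = "\<lambda>(S, R). (S \<union> R, S)" and j = "\<lambda>(T, S). (S, T - S)"])
    fix P assume "P \<in> (SIGMA T:{T. (r \<in> T \<and> u \<in> T) \<and> T \<subseteq> V}. {S. u \<in> S \<and> S \<subseteq> T - {r}})"
    then obtain T S where P: "P = (T, S)" "r \<in> T" "u \<in> T" "T \<subseteq> V" "u \<in> S" "S \<subseteq> T - {r}"
      by auto
    then have "V - S - (T - S) = V - T"
      by auto
    then show "(case case P of (T, S) \<Rightarrow> (S, T - S) of (S, R) \<Rightarrow>
        ((1 + t) ^ d S - 1) * ?c S * (?c R * Z (V - S - R))) =
        (case P of (T, S) \<Rightarrow> ((1 + t) ^ d S - 1) * ?c S * ?c (T - S) * Z (V - T))"
      by (simp add: P mult.assoc)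
  qed (use assms(2,3) in auto)
  also have "\<dots> = (\<Sum>S\<in>?\<S>. \<Sum>R | r \<in> R \<and> R \<subseteq> V - S.
      ((1 + t) ^ d S - 1) * ?c S * (?c R * Z (V - S - R)))"
    by (rule sum.Sigma[symmetric]) (use fin in auto)
  also have "\<dots> = (\<Sum>S\<in>?\<S>. ((1 + t) ^ d S - 1) * ?c S * Z (V - S))"
    unfolding sum_distrib_left[symmetric]
    by (intro sum.cong refl arg_cong2[where f = "(*)"] Z) (use assms(2) in auto)
  finally have g: "(\<Sum>T | (r \<in> T \<and> u \<in> T) \<and> T \<subseteq> V. g T * Z (V - T)) =
      (\<Sum>S\<in>?\<S>. ((1 + t) ^ d S - 1) * ?c S * Z (V - S))" .
  \<comment> \<open>If \<open>u\<close> is outside \<open>T\<close>, it has a component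
    \<open>S\<close> of its own in the rest; expanding \<open>Z (V - T)\<close> there gives the same
    sum over \<open>S\<close> without the factor \<open>(1 + t) ^ d S - 1\<close>.\<close>
  have "(\<Sum>T | (r \<in> T \<and> u \<notin> T) \<and> T \<subseteq> V. ?c T * Z (V - T)) =
      (\<Sum>T | (r \<in> T \<and> u \<notin> T) \<and> T \<subseteq> V. ?c T * (\<Sum>S | u \<in> S \<and> S \<subseteq> V - T. ?c S * Z (V - T - S)))"
    by (intro sum.cong refl arg_cong2[where f = "(*)"] Z[symmetric]) (use assms(3) in auto)
  also have "\<dots> = (\<Sum>(T, S)\<in>(SIGMA T:{T. (r \<in> T \<and> u \<notin> T) \<and> T \<subseteq> V}. {S. u \<in> S \<and> S \<subseteq> V - T}).
      ?c T * (?c S * Z (V - T - S)))"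
    unfolding sum_distrib_left by (rule sum.Sigma) (use fin in auto)
  also have "\<dots> = (\<Sum>(S, R)\<in>(SIGMA S:?\<S>. {R. r \<in> R \<and> R \<subseteq> V - S}). ?c S * (?c R * Z (V - S - R)))"
  proof (rule sum.reindex_bij_witness[where i = "\<lambda>(S, R). (R, S)" and j = "\<lambda>(T, S). (S, T)"])
    fix P assume "P \<in> (SIGMA T:{T. (r \<in> T \<and> u \<notin> T) \<and> T \<subseteq> V}. {S. u \<in> S \<and> S \<subseteq> V - T})"
    then obtain T S where P: "P = (T, S)" by auto
    have "V - S - T = V - T - S" by auto
    then show "(case case P of (T, S) \<Rightarrow> (S, T) of (S, R) \<Rightarrow> ?c S * (?c R * Z (V - S - R))) =
        (case P of (T, S) \<Rightarrow> ?c T * (?c S * Z (V - T - S)))"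
      by (simp add: P mult_ac)
  qed auto
  also have "\<dots> = (\<Sum>S\<in>?\<S>. \<Sum>R | r \<in> R \<and> R \<subseteq> V - S. ?c S * (?c R * Z (V - S - R)))"
    by (rule sum.Sigma[symmetric]) (use fin in auto)
  also have "\<dots> = (\<Sum>S\<in>?\<S>. ?c S * Z (V - S))"
    unfolding sum_distrib_left[symmetric]
    by (intro sum.cong refl arg_cong2[where f = "(*)"] Z) (use assms(2) in auto)
  finally have c: "(\<Sum>T | (r \<in> T \<and> u \<notin> T) \<and> T \<subseteq> V. ?c T * Z (V - T)) = (\<Sum>S\<in>?\<S>. ?c S * Z (V - S))" .
  have Z_insert: "Z (insert r S) = (1 + t) ^ d S * Z S" if "S \<subseteq> V - {r}" for S
    unfolding Z_def d_def
    by (subst card_edges_insert) (use that assms(1) E in \<open>auto simp: power_add intro: finite_subset\<close>)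
  have d_split: "d S + d (V - {r} - S) = d (V - {r})" if "S \<subseteq> V - {r}" for S
    unfolding d_def
    by (subst card_Un_disjoint[symmetric])
      (use that assms(1) in \<open>auto intro: finite_subset intro!: arg_cong[where f = card]\<close>)
  have "(\<Sum>T | r \<in> T \<and> T \<subseteq> V. (if u \<in> T then g T else ?c T) * Z (V - T)) =
      (\<Sum>S\<in>?\<S>. ((1 + t) ^ d S - 1) * ?c S * Z (V - S)) + (\<Sum>S\<in>?\<S>. ?c S * Z (V - S))"
    unfolding split g[symmetric] c[symmetric]
    by (subst sum.union_disjoint) (use fin in auto)
  also have "\<dots> = (\<Sum>S\<in>?\<S>. (1 + t) ^ d S * ?c S * Z (V - S))"
    unfolding sum.distrib[symmetric] by (simp add: algebra_simps)
  \<comment> \<open>The edges from \<open>r\<close> to \<open>S\<close> and those from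
    \<open>r\<close> to the rest, counted in \<open>Z (V - S)\<close>, are together all edges at
    \<open>r\<close>: a factor independent of \<open>S\<close>.\<close>
  also have "\<dots> = (\<Sum>S\<in>?\<S>. (1 + t) ^ d (V - {r}) * (?c S * Z (V - {r} - S)))"
  proof (intro sum.cong refl)
    fix S assume S: "S \<in> ?\<S>"
    then have "V - S = insert r (V - {r} - S)"
      using assms(2) by auto
    then have "Z (V - S) = (1 + t) ^ d (V - {r} - S) * Z (V - {r} - S)"
      by (simp only:) (rule Z_insert, auto)
    then show "(1 + t) ^ d S * ?c S * Z (V - S) = (1 + t) ^ d (V - {r}) * (?c S * Z (V - {r} - S))"
      using S d_split[of S] by (simp add: power_add[symmetric] mult_ac flip: d_split[of S])
  qed
  also have "\<dots> = (1 + t) ^ d (V - {r}) * Z (V - {r})"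
    unfolding sum_distrib_left[symmetric] using Z[of "V - {r}" u] assms(3,4) by simp
  also have "\<dots> = Z V"
    using Z_insert[of "V - {r}"] assms(2) by (simp add: insert_absorb)
  finally show ?thesis .
qed

text \<open>Deleting \<open>r\<close> from a connected graph leaves the component \<open>S\<close> of \<open>u\<close>, which is joined to \<open>r\<close> by
  a nonempty set of edges; the remaining vertices still form a connected graph.\<close>

lemma conn_sum_recurrence:
  fixes t :: "'a::comm_ring_1"
  assumes "finite V" "r \<in> V" "u \<in> V" "r \<noteq> u" and E: "\<And>e. e \<in> E \<Longrightarrow> card e = 2"
  shows "conn_sum t E V = (\<Sum>S | u \<in> S \<and> S \<subseteq> V - {r}.
    ((1 + t) ^ card {x \<in> S. {r, x} \<in> E} - 1) * conn_sum t E S * conn_sum t E (V - S))"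
  using assms(1-3)
proof (induction V rule: finite_psubset_induct)
  case (psubset V)
  let ?c = "conn_sum t E" and ?Z = "\<lambda>V. (1 + t) ^ card (E \<inter> Pow V)"
  define g where "g = (\<lambda>V. \<Sum>S | u \<in> S \<and> S \<subseteq> V - {r}.
       ((1 + t) ^ card {x \<in> S. {r, x} \<in> E} - 1) * ?c S * ?c (V - S))"
  let ?T = "{T. r \<in> T \<and> T \<subseteq> V}"
  have "(\<Sum>T\<in>?T. (if u \<in> T then g T else ?c T) * ?Z (V - T)) = (\<Sum>T\<in>?T. ?c T * ?Z (V - T))"
    unfolding g_def
    using conn_sum_recurrence_convolved[OF psubset.hyps(1) psubset.prems assms(4) E, where t = t]
      power_card_eq_sum_conn_sum[OF psubset.hyps(1) psubset.prems(1) E, where t = t] by simp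
  \<comment> \<open>Proper subsets containing \<open>u\<close> agree by induction, the others
    trivially, so only \<open>T = V\<close> remains; its factor \<open>?Z {}\<close> is 1 because
    \<open>{}\<close> is not an edge.\<close>
  moreover have "(\<Sum>T\<in>?T - {V}. (if u \<in> T then g T else ?c T) * ?Z (V - T)) =
      (\<Sum>T\<in>?T - {V}. ?c T * ?Z (V - T))"
  proof (intro sum.cong refl arg_cong2[where f = "(*)"])
    fix T assume T: "T \<in> ?T - {V}"
    then have "T \<subset> V"
      by blast
    then show "(if u \<in> T then g T else ?c T) = ?c T"
      using psubset.IH[of T] T by (auto simp: g_def)
  qed
  moreover have "V \<in> ?T" "finite ?T"
    using psubset by auto
  ultimately have "g V * ?Z {} = ?c V * ?Z {}"
    using psubset.prems by (simp add: sum.remove[of ?T V])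
  moreover have "E \<inter> {{}} = {}"
    using E[of "{}"] by auto
  ultimately show ?case
    by (simp add: g_def)
qed

subsection \<open>Nonnegativity\<close>

text \<open>The semiring generated by \<open>y\<close> over the natural numbers. Working with values
  avoids naming the polynomials in the recursion.\<close>

definition nonneg_poly_values :: "'a::comm_ring_1 \<Rightarrow> 'a set" where
  "nonneg_poly_values y = {poly (map_poly of_int p) y | p :: int poly. \<forall>i. coeff p i \<ge> 0}"

lemma nonneg_poly_valuesI:
  "(\<And>i. coeff p i \<ge> 0) \<Longrightarrow> x = poly (map_poly of_int p) y \<Longrightarrow> x \<in> nonneg_poly_values y"
  by (auto simp: nonneg_poly_values_def)

lemma nonneg_poly_values_0: "0 \<in> nonneg_poly_values y"
  by (rule nonneg_poly_valuesI[of 0]) simp_all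

lemma nonneg_poly_values_1: "1 \<in> nonneg_poly_values y"
  by (rule nonneg_poly_valuesI[of 1]) (auto simp: coeff_1)

lemma nonneg_poly_values_self: "y \<in> nonneg_poly_values y"
  by (rule nonneg_poly_valuesI[of "[:0, 1:]"]) (auto simp: coeff_pCons map_poly_pCons split: nat.split)

lemma nonneg_poly_values_add:
  assumes "a \<in> nonneg_poly_values y" "b \<in> nonneg_poly_values y"
  shows "a + b \<in> nonneg_poly_values y"
proof -
  obtain p p' :: "int poly" where p: "\<And>i. coeff p i \<ge> 0" "a = poly (map_poly of_int p) y"
    and p': "\<And>i. coeff p' i \<ge> 0" "b = poly (map_poly of_int p') y"
    using assms by (auto simp: nonneg_poly_values_def)
  have "map_poly of_int (p + p') = (map_poly of_int p + map_poly of_int p' :: 'a poly)"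
    by (rule poly_eqI) (simp add: coeff_map_poly)
  then show ?thesis
    using p p' by (intro nonneg_poly_valuesI[of "p + p'"]) simp_all
qed

lemma nonneg_poly_values_mult:
  assumes "a \<in> nonneg_poly_values y" "b \<in> nonneg_poly_values y"
  shows "a * b \<in> nonneg_poly_values y"
proof -
  obtain p p' :: "int poly" where p: "\<And>i. coeff p i \<ge> 0" "a = poly (map_poly of_int p) y"
    and p': "\<And>i. coeff p' i \<ge> 0" "b = poly (map_poly of_int p') y"
    using assms by (auto simp: nonneg_poly_values_def)
  have "map_poly of_int (p * p') = (map_poly of_int p * map_poly of_int p' :: 'a poly)"
    by (rule poly_eqI) (simp add: coeff_map_poly coeff_mult)
  then show ?thesis
    using p p' by (intro nonneg_poly_valuesI[of "p * p'"]) (simp_all add: coeff_mult sum_nonneg)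
qed

lemma nonneg_poly_values_sum:
  "(\<And>x. x \<in> A \<Longrightarrow> f x \<in> nonneg_poly_values y) \<Longrightarrow> sum f A \<in> nonneg_poly_values y"
  by (induction A rule: infinite_finite_induct) (auto intro: nonneg_poly_values_0 nonneg_poly_values_add)

lemma nonneg_poly_values_power: "a \<in> nonneg_poly_values y \<Longrightarrow> a ^ k \<in> nonneg_poly_values y"
  by (induction k) (auto intro: nonneg_poly_values_1 nonneg_poly_values_mult)

text \<open>The factor \<open>y ^ d - 1\<close> of the vertex recurrence is \<open>y - 1\<close>
  times a geometric sum and supplies the one power missing from
  \<open>(card S - 1) + (card (V - S) - 1)\<close>. The product form makes sense even where
  \<open>y - 1\<close> cannot be cancelled, and for disconnected graphs \<open>P = 0\<close> will
  do.\<close>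

lemma conn_sum_eq_power_times_nonneg_poly:
  fixes y :: "'a::comm_ring_1"
  assumes "finite V" "V \<noteq> {}" and E: "\<And>e. e \<in> E \<Longrightarrow> card e = 2"
  shows "\<exists>P\<in>nonneg_poly_values y. conn_sum (y - 1) E V = (y - 1) ^ (card V - 1) * P"
  using assms(1,2)
proof (induction V rule: finite_psubset_induct)
  case (psubset V)
  let ?c = "conn_sum (y - 1) E"
  obtain r where r: "r \<in> V"
    using psubset.prems by auto
  show ?case
  proof (cases "V = {r}")
    case True
    have "{T. r \<in> T \<and> T \<subseteq> {r}} = {{r}}"
      by auto
    moreover have "E \<inter> Pow {r} = {}"
      using E[of "{}"] E[of "{r}"] by (auto simp: subset_singleton_iff)
    moreover have "E \<inter> {{}} = {}"
      using E[of "{}"] by auto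
    ultimately have "?c V = 1"
      using power_card_eq_sum_conn_sum[of "{r}" r E, where t = "y - 1"] E True by simp
    then show ?thesis
      using True nonneg_poly_values_1[of y] by auto
  next
    case False
    then obtain u where u: "u \<in> V" "r \<noteq> u"
      using r by auto
    define f where "f S = (y ^ card {x \<in> S. {r, x} \<in> E} - 1) * ?c S * ?c (V - S)" for S
    have "\<exists>P\<in>nonneg_poly_values y. f S = (y - 1) ^ (card V - 1) * P" if S: "u \<in> S" "S \<subseteq> V - {r}" for S
    proof -
      obtain P where P: "P \<in> nonneg_poly_values y" "?c S = (y - 1) ^ (card S - 1) * P"
        using psubset.IH[of S] S r by blast
      have "V - S \<subset> V" "V - S \<noteq> {}"
        using S r u by auto
      then obtain P' where P': "P' \<in> nonneg_poly_values y" "?c (V - S) = (y - 1) ^ (card (V - S) - 1) * P'"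
        using psubset.IH[of "V - S"] by blast
      define k where "k = card {x \<in> S. {r, x} \<in> E}"
      have fin: "finite S" "finite (V - S)"
        using psubset.hyps S finite_subset by auto
      then have "card S > 0" "card (V - S) > 0"
        using S r by (auto simp: card_gt_0_iff)
      moreover have "card V = card S + card (V - S)"
        using card_Un_disjoint[of S "V - S"] fin S by (simp add: Un_absorb1 Un_commute subset_Diff_insert)
      ultimately have V: "card V - 1 = Suc (card S - 1 + (card (V - S) - 1))"
        by simp
      have "f S = (y - 1) ^ (card V - 1) * ((\<Sum>i<k. y ^ i) * P * P')"
        unfolding f_def P P' V k_def[symmetric] power_diff_1_eq
        by (simp add: power_add mult_ac)
      then show ?thesis
        using P P' by (auto intro!: bexI nonneg_poly_values_mult nonneg_poly_values_sum
            nonneg_poly_values_power nonneg_poly_values_self)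
    qed
    then obtain P where P: "\<And>S. u \<in> S \<and> S \<subseteq> V - {r} \<Longrightarrow>
        P S \<in> nonneg_poly_values y \<and> f S = (y - 1) ^ (card V - 1) * P S"
      by metis
    have "?c V = (\<Sum>S | u \<in> S \<and> S \<subseteq> V - {r}. f S)"
      using conn_sum_recurrence[OF psubset.hyps(1) r u(1,2) E, where t = "y - 1"] by (simp add: f_def)
    also have "\<dots> = (y - 1) ^ (card V - 1) * (\<Sum>S | u \<in> S \<and> S \<subseteq> V - {r}. P S)"
      using P by (simp add: sum_distrib_left)
    finally show ?thesis
      using P by (auto intro!: bexI nonneg_poly_values_sum)
  qed
qed

subsection \<open>The continued fraction and Dyck paths\<close>

text \<open>Total weight of the \<open>n\<close>-step paths from height \<open>h\<close> to 0 that
  stay nonnegative; a rise weighs 1, a fall from height \<open>i\<close> weighs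
  \<open>a i\<close>.\<close>

fun path_weight :: "(nat \<Rightarrow> 'a::comm_ring_1) \<Rightarrow> nat \<Rightarrow> nat \<Rightarrow> 'a" where
  "path_weight a 0 h = (if h = 0 then 1 else 0)"
| "path_weight a (Suc n) h =
     path_weight a n (Suc h) + (case h of 0 \<Rightarrow> 0 | Suc k \<Rightarrow> a h * path_weight a n k)"

text \<open>The limit of the tails at level \<open>k\<close>: depth \<open>Suc m\<close> already
  fixes coefficient \<open>m\<close>. All levels are needed because the continued fraction equation
  relates \<open>k\<close> to \<open>Suc k\<close>.\<close>

definition s_frac_from :: "(nat \<Rightarrow> 'a::field) \<Rightarrow> nat \<Rightarrow> 'a fps" where
  "s_frac_from a k = Abs_fps (\<lambda>m. fps_nth (s_frac_tail a (Suc m) k) m)"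

lemma s_frac_from_nth: "m < N \<Longrightarrow> fps_nth (s_frac_from a k) m = fps_nth (s_frac_tail a N k) m"
  unfolding s_frac_from_def fps_nth_Abs_fps by (rule s_frac_tail_nth_eq[symmetric]) auto

lemma s_frac_eq_s_frac_from: "s_frac a = s_frac_from a 1"
  unfolding s_frac_def
proof (rule limI, rule tendsto_fpsI)
  fix m
  show "\<forall>\<^sub>F N in sequentially. fps_nth (s_frac_tail a N 1) m = fps_nth (s_frac_from a 1) m"
    by (rule eventually_sequentiallyI[of "Suc m"], rule s_frac_from_nth[symmetric]) simp
qed

lemma s_frac_from_eq:
  "s_frac_from a k * (1 - fps_const (a k) * fps_X ^ 2 * s_frac_from a (Suc k)) = 1"
proof (rule fps_ext)
  fix m
  \<comment> \<open>Depth \<open>m + 2\<close> leaves depth \<open>m + 1\<close> after one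
    unfolding, enough for all coefficients up to \<open>m\<close>.\<close>
  let ?T = "s_frac_tail a (Suc (Suc m)) k" and ?T' = "s_frac_tail a (Suc m) (Suc k)"
  let ?H = "1 - fps_const (a k) * fps_X ^ 2 * s_frac_from a (Suc k)"
  let ?H' = "1 - fps_const (a k) * fps_X ^ 2 * ?T'"
  have "fps_nth ?H i = fps_nth ?H' i" if "i \<le> m" for i
    using that by (simp add: mult.assoc fps_X_power_mult_nth s_frac_from_nth[of _ "Suc m"]
        del: s_frac_tail.simps)
  then have "fps_nth (s_frac_from a k * ?H) m = fps_nth (?T * ?H') m"
    unfolding fps_mult_nth
    by (intro sum.cong refl arg_cong2[where f = "(*)"] s_frac_from_nth) auto
  also have "?T * ?H' = 1"
    by (simp only: s_frac_tail.simps(2)[of a "Suc m"]) (rule inverse_mult_eq_1, simp)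
  finally show "fps_nth (s_frac_from a k * ?H) m = fps_nth 1 m" .
qed

text \<open>The generating function of the paths from height \<open>h\<close> to height \<open>0\<close>, factored at the first
  visits of the heights \<open>h - 1, \<dots>, 0\<close>.\<close>

lemma path_weight_eq_nth:
  fixes a :: "nat \<Rightarrow> 'a::field"
  shows "path_weight a n h =
    fps_nth (fps_const (\<Prod>i=1..h. a i) * fps_X ^ h * (\<Prod>i=1..Suc h. s_frac_from a i)) n"
proof -
  let ?S = "s_frac_from a"
  define D where "D h = fps_const (\<Prod>i=1..h. a i) * fps_X ^ h * (\<Prod>i=1..Suc h. ?S i)" for h
  \<comment> \<open>The recursion of \<open>path_weight\<close> for generating functions:
    \<open>D h - fps_X * D (Suc h)\<close> contains as a factor the left side of the continued
    fraction equation at level \<open>Suc h\<close>, which is 1.\<close>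
  have rec: "D h = fps_X * D (Suc h) +
      (case h of 0 \<Rightarrow> 1 | Suc k \<Rightarrow> fps_X * (fps_const (a h) * D k))" for h
  proof -
    have "D h - fps_X * D (Suc h) = fps_const (\<Prod>i=1..h. a i) * fps_X ^ h * (\<Prod>i=1..h. ?S i) *
        (?S (Suc h) * (1 - fps_const (a (Suc h)) * fps_X ^ 2 * ?S (Suc (Suc h))))"
      by (simp add: D_def algebra_simps power2_eq_square flip: fps_const_mult)
    also have "\<dots> = (case h of 0 \<Rightarrow> 1 | Suc k \<Rightarrow> fps_X * (fps_const (a h) * D k))"
      unfolding s_frac_from_eq
      by (cases h) (simp_all add: D_def mult_ac flip: fps_const_mult)
    finally show ?thesis by (simp add: algebra_simps)
  qed
  have "path_weight a n h = fps_nth (D h) n"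
  proof (induction n arbitrary: h)
    case 0
    have "fps_nth (?S i) 0 = 1" for i
      by (subst s_frac_from_nth[of _ 1]) (simp_all add: s_frac_tail_nth_0)
    then show ?case
      by (cases h) (simp_all add: D_def mult.assoc)
  next
    case (Suc n)
    have "fps_nth (D h) (Suc n) = fps_nth (D (Suc h)) n +
        (case h of 0 \<Rightarrow> 0 | Suc k \<Rightarrow> a h * fps_nth (D k) n)"
      by (subst rec) (simp split: nat.split)
    then show ?case
      by (simp add: Suc split: nat.split)
  qed
  then show ?thesis by (simp add: D_def)
qed

lemma s_frac_nth: "fps_nth (s_frac a) n = path_weight a n 0"
  by (simp add: s_frac_eq_s_frac_from path_weight_eq_nth)

subsection \<open>Moments as crossing generating functions\<close>

text \<open>Removing arches from \<open>{1..2 * n}\<close> leaves gaps, so arbitrary point sets are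
  needed; crossings depend only on the order of the points.\<close>

definition matchings_on :: "nat set \<Rightarrow> nat set set set" where
  "matchings_on S = {\<sigma>. partition_on S \<sigma> \<and> (\<forall>b\<in>\<sigma>. card b = 2)}"

lemma matchings_eq: "matchings n = matchings_on {1..2 * n}"
  by (simp add: matchings_def matchings_on_def)

lemma matchings_on_Union: "\<sigma> \<in> matchings_on S \<Longrightarrow> \<Union>\<sigma> = S"
  by (auto simp: matchings_on_def partition_on_def)

lemma matchings_on_disjoint: "\<sigma> \<in> matchings_on S \<Longrightarrow> a \<in> \<sigma> \<Longrightarrow> b \<in> \<sigma> \<Longrightarrow> x \<in> a \<Longrightarrow> x \<in> b \<Longrightarrow> a = b"
  by (auto simp: matchings_on_def partition_on_def disjoint_def)

lemma matchings_on_card: "\<sigma> \<in> matchings_on S \<Longrightarrow> b \<in> \<sigma> \<Longrightarrow> card b = 2"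
  by (auto simp: matchings_on_def)

lemma matchings_onI:
  assumes "\<Union>\<sigma> = S" "\<And>b. b \<in> \<sigma> \<Longrightarrow> card b = 2"
    and "\<And>a b x. a \<in> \<sigma> \<Longrightarrow> b \<in> \<sigma> \<Longrightarrow> x \<in> a \<Longrightarrow> x \<in> b \<Longrightarrow> a = b"
  shows "\<sigma> \<in> matchings_on S"
proof -
  have "{} \<notin> \<sigma>"
    using assms(2)[of "{}"] by auto
  moreover have "disjoint \<sigma>"
    using assms(3) by (fastforce simp: disjoint_def)
  ultimately show ?thesis
    using assms(1,2) by (simp add: matchings_on_def partition_on_def)
qed

lemma finite_matchings_on: "finite S \<Longrightarrow> finite (matchings_on S)"
  by (rule finite_subset[of _ "Pow (Pow S)"]) (auto simp: matchings_on_def partition_on_def)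

lemma finite_matching: "finite S \<Longrightarrow> \<sigma> \<in> matchings_on S \<Longrightarrow> finite \<sigma>"
  by (rule finite_subset[of _ "Pow S"]) (auto simp: matchings_on_def partition_on_def)

lemma matchings_on_empty: "matchings_on {} = {{}}"
  by (auto simp: matchings_on_def partition_on_def)

lemma matchings_on_insert_iff:
  assumes "x \<noteq> y" "x \<in> S" "y \<in> S" "{x, y} \<notin> \<tau>"
  shows "insert {x, y} \<tau> \<in> matchings_on S \<longleftrightarrow> \<tau> \<in> matchings_on (S - {x, y})"
proof
  assume *: "insert {x, y} \<tau> \<in> matchings_on S"
  show "\<tau> \<in> matchings_on (S - {x, y})"
  proof (rule matchings_onI)
    have "z \<notin> {x, y}" if "b \<in> \<tau>" "z \<in> b" for z b
      using that matchings_on_disjoint[OF *, of b "{x, y}" z] assms(4) by blast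
    then show "\<Union>\<tau> = S - {x, y}"
      using matchings_on_Union[OF *] by fastforce
    show "card b = 2" if "b \<in> \<tau>" for b
      using that matchings_on_card[OF *] by simp
    show "a = b" if "a \<in> \<tau>" "b \<in> \<tau>" "z \<in> a" "z \<in> b" for a b z
      using that matchings_on_disjoint[OF *, of a b z] by simp
  qed
next
  assume *: "\<tau> \<in> matchings_on (S - {x, y})"
  have notin: "z \<notin> {x, y}" if "b \<in> \<tau>" "z \<in> b" for z b
    using that matchings_on_Union[OF *] by blast
  show "insert {x, y} \<tau> \<in> matchings_on S"
  proof (rule matchings_onI)
    show "\<Union>(insert {x, y} \<tau>) = S"
      using matchings_on_Union[OF *] assms by auto
    show "card b = 2" if "b \<in> insert {x, y} \<tau>" for b
      using that matchings_on_card[OF *] assms(1) by auto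
    show "a = b" if "a \<in> insert {x, y} \<tau>" "b \<in> insert {x, y} \<tau>" "z \<in> a" "z \<in> b" for a b z
    proof -
      have "a = {x, y} \<and> b = {x, y} \<or> a \<in> \<tau> \<and> b \<in> \<tau>"
        using that notin[of a z] notin[of b z] by auto
      then show ?thesis
        using that(3,4) matchings_on_disjoint[OF *, of a b z] by auto
    qed
  qed
qed

section \<open>Crossings as edges of one ambient graph\<close>

lemma crosses_iff:
  assumes "x < y" "u < v"
  shows "crosses {x, y} {u, v} \<longleftrightarrow> x < u \<and> u < y \<and> y < v"
  using assms unfolding crosses_def by (auto simp: doubleton_eq_iff)

text \<open>All crossing graphs are induced subgraphs of one graph, so \<open>conn_sum\<close> can
  use the same edge set for a matching and all its subsets.\<close>

lemma crossing_edges_eq: "crossing_edges \<sigma> = crossing_edges UNIV \<inter> Pow \<sigma>"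
  by (auto simp: crossing_edges_def)

lemma crossing_edges_mem_iff: "{a, b} \<in> crossing_edges UNIV \<longleftrightarrow> crosses a b \<or> crosses b a"
  by (auto simp: crossing_edges_def doubleton_eq_iff)

lemma card_crossing_edge: "e \<in> crossing_edges UNIV \<Longrightarrow> card e = 2"
proof -
  have "\<not> crosses a a" for a
    by (auto simp: crosses_def doubleton_eq_iff)
  then show "e \<in> crossing_edges UNIV \<Longrightarrow> card e = 2"
    by (auto simp: crossing_edges_def card_2_iff) metis
qed

text \<open>When all of \<open>L\<close> lies to the left of \<open>S\<close>, the points of \<open>L\<close> are the left ends of the arches that are
  still open when the points of \<open>S\<close> are about to be read. The least point of \<open>S\<close> either opens an arch
  or closes the arch at some \<open>l \<in> L\<close>, crossing the arches opened after \<open>l\<close>.\<close>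

definition open_matchings :: "nat set \<Rightarrow> nat set \<Rightarrow> nat set set set" where
  "open_matchings L S = {\<sigma> \<in> matchings_on (L \<union> S). \<forall>b\<in>\<sigma>. \<not> b \<subseteq> L}"

text \<open>Ranked from the largest down, the elements of \<open>L\<close> have exponents 0, 1, ...,
  \<open>card L - 1\<close>. This is the source of the weight \<open>[h]_q\<close> of closing one of
  \<open>h\<close> open arches.\<close>

lemma sum_power_card_greater:
  fixes L :: "nat set" and y :: "'a::comm_ring_1"
  assumes "finite L"
  shows "(\<Sum>l\<in>L. y ^ card {l' \<in> L. l < l'}) = (\<Sum>j<card L. y ^ j)"
  using assms
proof (induction L rule: finite_linorder_min_induct)
  case (insert b A)
  have "{l' \<in> insert b A. b < l'} = A"
    using insert by auto
  moreover have "{l' \<in> insert b A. l < l'} = {l' \<in> A. l < l'}" if "l \<in> A" for l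
    using insert that by auto
  moreover have "b \<notin> A"
    using insert by auto
  ultimately show ?case
    using insert by simp
qed simp

text \<open>Every other arch ends after \<open>s\<close>, so it crosses \<open>{l, s}\<close>
  exactly when it starts between \<open>l\<close> and \<open>s\<close>. The points of
  \<open>L\<close> beyond \<open>l\<close> are precisely such starting points, one for each
  arch.\<close>

lemma card_crossing_edges_insert_open:
  assumes fin: "finite L" "finite S" and less: "\<And>x y. x \<in> L \<Longrightarrow> y \<in> S \<Longrightarrow> x < y"
    and l: "l \<in> L" and s: "s \<in> S" "\<And>y. y \<in> S \<Longrightarrow> s \<le> y"
    and \<tau>: "\<tau> \<in> open_matchings (L - {l}) (S - {s})"
  shows "card (crossing_edges (insert {l, s} \<tau>)) = card {l' \<in> L. l < l'} + card (crossing_edges \<tau>)"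
proof -
  have \<tau>': "\<tau> \<in> matchings_on (L - {l} \<union> (S - {s}))" and nsub: "\<And>b. b \<in> \<tau> \<Longrightarrow> \<not> b \<subseteq> L - {l}"
    using \<tau> by (auto simp: open_matchings_def)
  have ls: "l < s"
    using less l s by auto
  then have "s \<notin> L" "l \<notin> S"
    using less s l by fastforce+
  then have notin: "{l, s} \<notin> \<tau>"
    using matchings_on_Union[OF \<tau>'] ls by auto
  \<comment> \<open>No arch lies inside \<open>L\<close>, so the right end of each arch is in
    \<open>S\<close>, hence after \<open>s\<close>.\<close>
  have block: "\<exists>x z. b = {x, z} \<and> x < z \<and> z \<in> S \<and> s < z \<and> (x \<in> L \<or> s < x)" if b: "b \<in> \<tau>" for b
  proof -
    obtain x z where xz: "b = {x, z}" "x < z"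
      using matchings_on_card[OF \<tau>' b] by (metis card_2_iff insert_commute linorder_neqE_nat)
    then have "x \<in> L - {l} \<union> (S - {s})" "z \<in> L - {l} \<union> (S - {s})"
      using matchings_on_Union[OF \<tau>'] b by auto
    moreover have "z \<notin> L"
    proof
      assume "z \<in> L"
      then have "x \<notin> S"
        using less xz by fastforce
      then show False
        using calculation nsub[OF b] xz \<open>z \<in> L\<close> \<open>l \<notin> S\<close> less by fastforce
    qed
    moreover have "s < w" if "w \<in> S - {s}" for w
      using that s(2)[of w] by auto
    ultimately have "z \<in> S" "s < z" "x \<in> L \<or> s < x"
      by blast+
    then show ?thesis
      using xz by blast
  qed
  let ?C = "{b \<in> \<tau>. {{l, s}, b} \<in> crossing_edges UNIV}"
  have C: "{x, z} \<in> ?C \<longleftrightarrow> x \<in> L \<and> l < x"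
    if "{x, z} \<in> \<tau>" "x < z" "s < z" "x \<in> L \<or> s < x" for x z
    using that ls less s by (auto simp: crossing_edges_mem_iff crosses_iff)
  have "bij_betw Min ?C {l' \<in> L. l < l'}"
    unfolding bij_betw_def
  proof
    show "inj_on Min ?C"
    proof (rule inj_onI)
      fix a b assume ab: "a \<in> ?C" "b \<in> ?C" "Min a = Min b"
      have "Min c \<in> c" if "c \<in> \<tau>" for c
        using matchings_on_card[OF \<tau>' that] by (intro Min_in) (auto intro: card_ge_0_finite)
      from this[of a] this[of b] show "a = b"
        using ab matchings_on_disjoint[OF \<tau>', of a b "Min a"] by simp
    qed
    show "Min ` ?C = {l' \<in> L. l < l'}"
    proof (intro equalityI subsetI)
      fix m assume "m \<in> Min ` ?C"
      then obtain b where b: "b \<in> ?C" "m = Min b"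
        by blast
      then obtain x z where "b = {x, z}" "x < z" "s < z" "x \<in> L \<or> s < x"
        using block[of b] by auto
      then show "m \<in> {l' \<in> L. l < l'}"
        using b C[of x z] by auto
    next
      fix m assume m: "m \<in> {l' \<in> L. l < l'}"
      then obtain b where b: "b \<in> \<tau>" "m \<in> b"
        using matchings_on_Union[OF \<tau>'] by blast
      then obtain x z where xz: "b = {x, z}" "x < z" "z \<in> S" "s < z" "x \<in> L \<or> s < x"
        using block[of b] by auto
      then have "m = x"
        using b m less by fastforce
      moreover have "Min b = x"
        using xz by simp
      moreover have "{x, z} \<in> ?C"
        using b m xz \<open>m = x\<close> by (subst C) auto
      ultimately show "m \<in> Min ` ?C"
        using xz(1) by (intro image_eqI[of _ _ b]) simp_all
    qed
  qed
  then have "card ?C = card {l' \<in> L. l < l'}"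
    by (rule bij_betw_same_card)
  moreover have "finite \<tau>"
    using finite_matching[OF _ \<tau>'] fin by simp
  ultimately show ?thesis
    using card_edges_insert[of \<tau> "{l, s}" "crossing_edges UNIV"] notin card_crossing_edge
    by (simp add: crossing_edges_eq[of "insert {l, s} \<tau>"] crossing_edges_eq[of \<tau>])
qed

text \<open>As the points of \<open>S\<close> are read from the left, the number of open arches
  traces a path, and induction on \<open>card S\<close> mirrors the recursion of
  \<open>path_weight\<close>. This forces general \<open>L\<close>, since a point that opens an arch
  joins it.\<close>

lemma sum_open_matchings:
  fixes y :: "'a::comm_ring_1"
  assumes "finite L" "finite S" "\<And>x z. x \<in> L \<Longrightarrow> z \<in> S \<Longrightarrow> x < z"
  shows "(\<Sum>\<sigma>\<in>open_matchings L S. y ^ card (crossing_edges \<sigma>)) =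
    path_weight (\<lambda>i. \<Sum>j<i. y ^ j) (card S) (card L)"
  using assms
proof (induction "card S" arbitrary: L S)
  case 0
  then have S: "S = {}" by simp
  show ?case
  proof (cases "L = {}")
    case True
    then show ?thesis
      using S by (simp add: open_matchings_def matchings_on_empty crossing_edges_def conj_disj_distribR
          cong: conj_cong)
  next
    case False
    \<comment> \<open>With no points left to read, an arch open at a point of \<open>L\<close> can
      never be closed.\<close>
    have "open_matchings L S = {}"
    proof (rule equals0I)
      fix \<sigma> assume \<sigma>: "\<sigma> \<in> open_matchings L S"
      then have "\<Union>\<sigma> = L"
        using matchings_on_Union[of \<sigma> L] S by (simp add: open_matchings_def)
      then show False
        using \<sigma> False by (auto simp: open_matchings_def)
    qed
    then show ?thesis
      using S False 0 by simp
  qed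
next
  case (Suc n)
  define s where "s = Min S"
  have "S \<noteq> {}"
    using Suc.hyps(2) by auto
  then have s: "s \<in> S" "\<And>z. z \<in> S \<Longrightarrow> s \<le> z"
    using Suc.prems by (auto simp: s_def)
  have Ls: "x < s" if "x \<in> L" for x
    using Suc.prems that s by auto
  let ?w = "\<lambda>\<sigma>. y ^ card (crossing_edges \<sigma>)"
  have fin: "finite (open_matchings L S)"
    using finite_matchings_on[of "L \<union> S"] Suc.prems by (simp add: open_matchings_def)
  have S': "n = card (S - {s})"
    using Suc s by simp
  let ?A = "{\<sigma> \<in> open_matchings L S. \<forall>l\<in>L. {l, s} \<notin> \<sigma>}"
  let ?B = "\<lambda>l. {\<sigma> \<in> open_matchings L S. {l, s} \<in> \<sigma>}"
  have disj: "?B l \<inter> ?B l' = {}" if "l \<in> L" "l' \<in> L" "l \<noteq> l'" for l l'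
  proof (rule equals0I)
    fix \<sigma> assume "\<sigma> \<in> ?B l \<inter> ?B l'"
    then have "{l, s} = {l', s}"
      using matchings_on_disjoint[of \<sigma> "L \<union> S" "{l, s}" "{l', s}" s] by (auto simp: open_matchings_def)
    then show False
      using that Ls by (auto simp: doubleton_eq_iff)
  qed
  have "open_matchings L S = ?A \<union> (\<Union>l\<in>L. ?B l)"
    by auto
  then have "sum ?w (open_matchings L S) = sum ?w (?A \<union> (\<Union>l\<in>L. ?B l))"
    by simp
  also have "\<dots> = sum ?w ?A + sum ?w (\<Union>l\<in>L. ?B l)"
    by (rule sum.union_disjoint) (use fin Suc.prems in auto)
  also have "sum ?w (\<Union>l\<in>L. ?B l) = (\<Sum>l\<in>L. sum ?w (?B l))"
    by (rule sum.UNION_disjoint) (use fin Suc.prems disj in auto)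
  \<comment> \<open>Here \<open>s\<close> opens an arch: excluding the arches \<open>{l, s}\<close>
    is just what the condition on arches inside \<open>insert s L\<close> adds.\<close>
  also have "?A = open_matchings (insert s L) (S - {s})"
  proof -
    have un: "insert s L \<union> (S - {s}) = L \<union> S"
      using s by auto
    have "(\<forall>b\<in>\<sigma>. \<not> b \<subseteq> L) \<and> (\<forall>l\<in>L. {l, s} \<notin> \<sigma>) \<longleftrightarrow> (\<forall>b\<in>\<sigma>. \<not> b \<subseteq> insert s L)"
      if \<sigma>: "\<sigma> \<in> matchings_on (L \<union> S)" for \<sigma>
    proof
      assume *: "(\<forall>b\<in>\<sigma>. \<not> b \<subseteq> L) \<and> (\<forall>l\<in>L. {l, s} \<notin> \<sigma>)"
      show "\<forall>b\<in>\<sigma>. \<not> b \<subseteq> insert s L"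
      proof (intro ballI notI)
        fix b assume b: "b \<in> \<sigma>" "b \<subseteq> insert s L"
        then have "s \<in> b"
          using * by blast
        then obtain x where "b = {x, s}" "x \<noteq> s"
          using matchings_on_card[OF \<sigma> b(1)] by (auto simp: card_2_iff insert_commute)
        then show False
          using * b by auto
      qed
    qed (fastforce simp: subset_insertI2)
    then show ?thesis
      unfolding open_matchings_def un by blast
  qed
  also have "sum ?w (open_matchings (insert s L) (S - {s})) =
      path_weight (\<lambda>i. \<Sum>j<i. y ^ j) n (Suc (card L))"
    using Suc.hyps(1)[OF S', of "insert s L"] Suc.prems s Ls S'
    by (metis (no_types, lifting) Diff_iff card_insert_disjoint finite.insertI finite_Diff insertE
        insertI1 le_neq_implies_less less_irrefl)
  \<comment> \<open>Here \<open>s\<close> closes the arch at \<open>l\<close>. The truncated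
    \<open>card L - 1\<close> does no harm, as the sum is empty for \<open>L = {}\<close>.\<close>
  also have "(\<Sum>l\<in>L. sum ?w (?B l)) =
      (\<Sum>l\<in>L. y ^ card {l' \<in> L. l < l'} * path_weight (\<lambda>i. \<Sum>j<i. y ^ j) n (card L - 1))"
  proof (intro sum.cong refl)
    fix l assume l: "l \<in> L"
    have un: "L \<union> S - {l, s} = (L - {l}) \<union> (S - {s})"
      using l s Suc.prems(3) by fastforce
    have "sum ?w (?B l) = (\<Sum>\<tau>\<in>open_matchings (L - {l}) (S - {s}). y ^ card {l' \<in> L. l < l'} * ?w \<tau>)"
    proof (rule sum.reindex_bij_witness[where i = "insert {l, s}" and j = "\<lambda>\<sigma>. \<sigma> - {{l, s}}"])
      fix \<sigma> assume \<sigma>: "\<sigma> \<in> ?B l"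
      then show ins: "insert {l, s} (\<sigma> - {{l, s}}) = \<sigma>"
        by auto
      have "insert {l, s} (\<sigma> - {{l, s}}) \<in> matchings_on (L \<union> S)"
        unfolding ins using \<sigma> by (simp add: open_matchings_def)
      then have "\<sigma> - {{l, s}} \<in> matchings_on (L \<union> S - {l, s})"
        using Ls[OF l] l s by (subst (asm) matchings_on_insert_iff) auto
      then show mem: "\<sigma> - {{l, s}} \<in> open_matchings (L - {l}) (S - {s})"
        using \<sigma> un by (auto simp: open_matchings_def)
      show "y ^ card {l' \<in> L. l < l'} * ?w (\<sigma> - {{l, s}}) = ?w \<sigma>"
        using card_crossing_edges_insert_open[OF Suc.prems l s mem]
        unfolding ins by (simp add: power_add)
    next
      fix \<tau> assume \<tau>: "\<tau> \<in> open_matchings (L - {l}) (S - {s})"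
      then have \<tau>': "\<tau> \<in> matchings_on (L \<union> S - {l, s})"
        by (simp add: open_matchings_def un)
      have notin: "{l, s} \<notin> \<tau>"
        using matchings_on_Union[OF \<tau>'] by blast
      then show "insert {l, s} \<tau> - {{l, s}} = \<tau>"
        by simp
      have "insert {l, s} \<tau> \<in> matchings_on (L \<union> S)"
        using Ls[OF l] l s \<tau>' notin by (subst matchings_on_insert_iff) auto
      moreover have "\<not> b \<subseteq> L" if "b \<in> \<tau>" for b
      proof -
        have "l \<notin> b"
          using that matchings_on_Union[OF \<tau>'] by blast
        then show ?thesis
          using \<tau> that by (auto simp: open_matchings_def)
      qed
      moreover have "s \<notin> L"
        using Ls by auto
      ultimately show "insert {l, s} \<tau> \<in> ?B l"
        by (auto simp: open_matchings_def)
    qed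
    also have "\<dots> = y ^ card {l' \<in> L. l < l'} * sum ?w (open_matchings (L - {l}) (S - {s}))"
      by (simp add: sum_distrib_left)
    also have "sum ?w (open_matchings (L - {l}) (S - {s})) =
        path_weight (\<lambda>i. \<Sum>j<i. y ^ j) n (card L - 1)"
      using Suc.hyps(1)[OF S', of "L - {l}"] Suc.prems S' l by simp
    finally show "sum ?w (?B l) = y ^ card {l' \<in> L. l < l'} * path_weight (\<lambda>i. \<Sum>j<i. y ^ j) n (card L - 1)" .
  qed
  also have "\<dots> = (\<Sum>j<card L. y ^ j) * path_weight (\<lambda>i. \<Sum>j<i. y ^ j) n (card L - 1)"
    by (simp add: sum_power_card_greater[OF Suc.prems(1)] flip: sum_distrib_right)
  finally show ?case
    by (simp add: Suc.hyps(2)[symmetric] split: nat.split)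
qed

lemma q_neq_1: "q \<noteq> 1"
proof
  assume "q = 1"
  then have "to_fract [:0, 1:] = (to_fract 1 :: ratfun)"
    by (simp add: q_def)
  then show False
    by (simp add: one_pCons)
qed

text \<open>Only \<open>card S\<close> enters, so subsets of the points never have to be relabelled;
  for sets of odd size both sides are 0.\<close>

lemma sum_matchings_on:
  assumes "finite S"
  shows "(\<Sum>\<sigma>\<in>matchings_on S. q ^ card (crossing_edges \<sigma>)) = moment (card S)"
proof -
  have "q_int = (\<lambda>i. \<Sum>j<i. q ^ j)"
    using q_neq_1 by (auto simp: q_int_def sum_gp_strict)
  moreover have "open_matchings {} S = matchings_on S"
    by (auto simp: open_matchings_def dest: matchings_on_card)
  ultimately show ?thesis
    using sum_open_matchings[of "{}" S q] assms by (simp add: moment_def s_frac_nth)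
qed

subsection \<open>Cumulants as sums over connected structures\<close>

text \<open>The logarithm enters the proof only through its derivative, which leads to a recursion
  linear in the cumulants.\<close>

lemma fps_deriv_eq_fps_log:
  fixes F :: "'a::field_char_0 fps"
  assumes "fps_nth F 0 = 1"
  shows "fps_deriv F = fps_deriv (fps_log F) * F"
proof -
  have "fps_deriv (fps_log F) = (fps_deriv (fps_ln 1) oo (F - 1)) * fps_deriv (F - 1)"
    unfolding fps_log_def using assms by (intro fps_compose_deriv) simp
  also have "fps_deriv (fps_ln 1) oo (F - 1) = inverse (1 + fps_X) oo (F - 1)"
    by (simp add: fps_ln_deriv)
  also have "\<dots> = inverse ((1 + fps_X) oo (F - 1))"
    using assms by (intro fps_inverse_compose) simp_all
  also have "(1 + fps_X) oo (F - 1) = F"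
    using assms by (simp add: fps_compose_add_distrib)
  finally show ?thesis
    using assms inverse_mult_eq_1[of F] by (simp add: mult_ac)
qed

lemma moment_0: "moment 0 = 1"
  by (simp add: moment_def s_frac_nth)

lemma moment_Suc: "moment (Suc n) = (\<Sum>j\<le>n. of_nat (n choose j) * cumulant (Suc j) * moment (n - j))"
proof -
  let ?F = "Abs_fps (\<lambda>j. moment j / fact j)"
  have "fps_nth (fps_deriv ?F) n = fps_nth (fps_deriv (fps_log ?F) * ?F) n"
    by (subst fps_deriv_eq_fps_log) (simp_all add: moment_0)
  then have "of_nat (Suc n) * (moment (Suc n) / fact (Suc n)) =
      (\<Sum>j\<le>n. of_nat (Suc j) * fps_nth (fps_log ?F) (Suc j) * (moment (n - j) / fact (n - j)))"
    by (simp add: fps_mult_nth atLeast0AtMost)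
  also have "of_nat (Suc n) * (moment (Suc n) / fact (Suc n)) = moment (Suc n) / fact n"
    by (simp add: fact_Suc del: of_nat_Suc)
  finally have "moment (Suc n) = fact n *
      (\<Sum>j\<le>n. of_nat (Suc j) * fps_nth (fps_log ?F) (Suc j) * (moment (n - j) / fact (n - j)))"
    by (simp add: field_simps)
  also have "\<dots> = (\<Sum>j\<le>n. of_nat (n choose j) * cumulant (Suc j) * moment (n - j))"
    unfolding sum_distrib_left
  proof (intro sum.cong refl)
    fix j assume "j \<in> {..n}"
    then show "fact n * (of_nat (Suc j) * fps_nth (fps_log ?F) (Suc j) * (moment (n - j) / fact (n - j))) =
        of_nat (n choose j) * cumulant (Suc j) * moment (n - j)"
      by (simp add: cumulant_def binomial_fact fact_Suc del: of_nat_Suc)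
  qed
  finally show ?thesis .
qed

lemma sum_Pow_card:
  fixes f :: "nat \<Rightarrow> 'b::comm_semiring_1"
  assumes "finite B"
  shows "(\<Sum>Y\<in>Pow B. f (card Y)) = (\<Sum>j\<le>card B. of_nat (card B choose j) * f j)"
proof -
  have "(\<Sum>Y\<in>Pow B. f (card Y)) = (\<Sum>j\<le>card B. \<Sum>Y | Y \<in> Pow B \<and> card Y = j. f (card Y))"
    by (rule sum.group[symmetric]) (use assms in \<open>auto intro: card_mono\<close>)
  also have "\<dots> = (\<Sum>j\<le>card B. of_nat (card B choose j) * f j)"
    by (intro sum.cong refl) (simp add: n_subsets[OF assms])
  finally show ?thesis .
qed

text \<open>The binomials of the recursion count the sets \<open>X\<close> of given size containing
  \<open>s\<close>. In this form it has the same index set as the splitting of matchings below and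
  can be compared with it term by term.\<close>

lemma moment_eq_sum_subsets:
  assumes "finite S" "s \<in> S"
  shows "moment (card S) = (\<Sum>X | s \<in> X \<and> X \<subseteq> S. cumulant (card X) * moment (card (S - X)))"
proof -
  define B where "B = S - {s}"
  have B: "finite B" "s \<notin> B" "S = insert s B"
    using assms by (auto simp: B_def)
  have "(\<Sum>X | s \<in> X \<and> X \<subseteq> S. cumulant (card X) * moment (card (S - X))) =
      (\<Sum>Y\<in>Pow B. cumulant (Suc (card Y)) * moment (card B - card Y))"
  proof (rule sum.reindex_bij_witness[where i = "insert s" and j = "\<lambda>X. X - {s}"])
    fix X assume X: "X \<in> {X. s \<in> X \<and> X \<subseteq> S}"
    then have "finite X" "card X > 0"
      using assms(1) finite_subset by (auto simp: card_gt_0_iff)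
    then show "cumulant (Suc (card (X - {s}))) * moment (card B - card (X - {s})) =
        cumulant (card X) * moment (card (S - X))"
      using X assms by (simp add: card_Diff_subset B_def)
  qed (use B in auto)
  also have "\<dots> = moment (card S)"
    using B by (subst sum_Pow_card[of B "\<lambda>j. cumulant (Suc j) * moment (card B - j)"])
      (simp_all add: moment_Suc mult.assoc)
  finally show ?thesis by simp
qed

section \<open>Splitting matchings into connected pieces\<close>

lemma matchings_on_subset: "\<sigma> \<in> matchings_on S \<Longrightarrow> T \<subseteq> \<sigma> \<Longrightarrow> T \<in> matchings_on (\<Union>T)"
  by (rule matchings_onI) (auto dest: matchings_on_card matchings_on_disjoint)

lemma matchings_on_Diff:
  assumes "\<sigma> \<in> matchings_on S" "T \<subseteq> \<sigma>"
  shows "\<sigma> - T \<in> matchings_on (S - \<Union>T)"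
proof -
  have "b \<inter> \<Union>T = {}" if "b \<in> \<sigma> - T" for b
    using that assms(2) matchings_on_disjoint[OF assms(1), of b] by blast
  then have "\<Union>(\<sigma> - T) = S - \<Union>T"
    using matchings_on_Union[OF assms(1)] by blast
  then show ?thesis
    using matchings_on_subset[OF assms(1), of "\<sigma> - T"] by simp
qed

lemma matchings_on_Un:
  assumes T: "T \<in> matchings_on X" and U: "U \<in> matchings_on Y" and "X \<inter> Y = {}"
  shows "T \<union> U \<in> matchings_on (X \<union> Y)" "T \<inter> U = {}"
proof -
  have disj: "x \<notin> b" if "a \<in> T" "b \<in> U" "x \<in> a" for a b x
    using that matchings_on_Union[OF T] matchings_on_Union[OF U] assms(3) by blast
  show "T \<union> U \<in> matchings_on (X \<union> Y)"
  proof (rule matchings_onI)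
    show "\<Union>(T \<union> U) = X \<union> Y"
      using matchings_on_Union[OF T] matchings_on_Union[OF U] by simp
    show "card b = 2" if "b \<in> T \<union> U" for b
      using that matchings_on_card[OF T] matchings_on_card[OF U] by auto
    show "a = b" if "a \<in> T \<union> U" "b \<in> T \<union> U" "x \<in> a" "x \<in> b" for a b x
      using that disj[of a b x] disj[of b a x] matchings_on_disjoint[OF T, of a b x]
        matchings_on_disjoint[OF U, of a b x] by auto
  qed
  have "b = {}" if "b \<in> T" "b \<in> U" for b
    using disj[OF that] by auto
  then show "T \<inter> U = {}"
    using matchings_on_card[OF T, of "{}"] by fastforce
qed

definition conn_matching_sum :: "nat set \<Rightarrow> ratfun" where
  "conn_matching_sum X = (\<Sum>\<sigma>\<in>matchings_on X. conn_sum (q - 1) (crossing_edges UNIV) \<sigma>)"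

text \<open>The component \<open>T\<close> of the arch through \<open>s\<close> is sorted by the set
  \<open>X\<close> of points it covers; what remains is an arbitrary matching of
  \<open>S - X\<close>, whose total weight is a moment again. Crossings between the two parts carry
  no weight.\<close>

lemma moment_eq_sum_conn_matching_sum:
  assumes "finite S" "s \<in> S"
  shows "moment (card S) =
    (\<Sum>X | s \<in> X \<and> X \<subseteq> S. conn_matching_sum X * moment (card (S - X)))"
proof -
  let ?c = "conn_sum (q - 1) (crossing_edges UNIV)" and ?w = "\<lambda>\<sigma>. q ^ card (crossing_edges \<sigma>)"
  have w: "?w \<sigma> = (\<Sum>T | s \<in> \<Union>T \<and> T \<subseteq> \<sigma>. ?c T * ?w (\<sigma> - T))" if \<sigma>: "\<sigma> \<in> matchings_on S" for \<sigma>
  proof -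
    obtain b where b: "b \<in> \<sigma>" "s \<in> b"
      using matchings_on_Union[OF \<sigma>] assms(2) by blast
    \<comment> \<open>Choosing \<open>T\<close> through \<open>s\<close> rather than through the
      arch \<open>b\<close>, which depends on \<open>\<sigma>\<close>, lets the choice become a
      condition on \<open>X\<close>.\<close>
    have "{T. s \<in> \<Union>T \<and> T \<subseteq> \<sigma>} = {T. b \<in> T \<and> T \<subseteq> \<sigma>}"
      using b matchings_on_disjoint[OF \<sigma> _ b(1) _ b(2)] by blast
    then show ?thesis
      using power_card_eq_sum_conn_sum[OF finite_matching[OF assms(1) \<sigma>] b(1) card_crossing_edge,
          where t = "q - 1"]
      by (simp add: crossing_edges_eq[of \<sigma>] crossing_edges_eq[of "\<sigma> - _"])
  qed
  have "moment (card S) = (\<Sum>\<sigma>\<in>matchings_on S. ?w \<sigma>)"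
    by (simp add: sum_matchings_on assms(1))
  also have "\<dots> = (\<Sum>\<sigma>\<in>matchings_on S. \<Sum>T | s \<in> \<Union>T \<and> T \<subseteq> \<sigma>. ?c T * ?w (\<sigma> - T))"
    by (intro sum.cong refl w)
  also have "\<dots> = (\<Sum>(\<sigma>, T)\<in>(SIGMA \<sigma>:matchings_on S. {T. s \<in> \<Union>T \<and> T \<subseteq> \<sigma>}). ?c T * ?w (\<sigma> - T))"
    by (rule sum.Sigma) (use assms(1) finite_matching in \<open>auto intro: finite_matchings_on\<close>)
  also have "\<dots> = (\<Sum>(X, T, U)\<in>(SIGMA X:{X. s \<in> X \<and> X \<subseteq> S}. matchings_on X \<times> matchings_on (S - X)).
      ?c T * ?w U)"
  proof (rule sum.reindex_bij_witness[where i = "\<lambda>(X, T, U). (T \<union> U, T)"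
        and j = "\<lambda>(\<sigma>, T). (\<Union>T, T, \<sigma> - T)"])
    fix P assume "P \<in> (SIGMA \<sigma>:matchings_on S. {T. s \<in> \<Union>T \<and> T \<subseteq> \<sigma>})"
    then obtain \<sigma> T where P: "P = (\<sigma>, T)" "\<sigma> \<in> matchings_on S" "s \<in> \<Union>T" "T \<subseteq> \<sigma>"
      by auto
    then show "(case case P of (\<sigma>, T) \<Rightarrow> (\<Union>T, T, \<sigma> - T) of (X, T, U) \<Rightarrow> (T \<union> U, T)) = P"
      by auto
    have "\<Union>T \<subseteq> S"
      using P matchings_on_Union by blast
    then show "(case P of (\<sigma>, T) \<Rightarrow> (\<Union>T, T, \<sigma> - T)) \<in>
        (SIGMA X:{X. s \<in> X \<and> X \<subseteq> S}. matchings_on X \<times> matchings_on (S - X))"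
      using P matchings_on_subset[OF P(2,4)] matchings_on_Diff[OF P(2,4)] by simp
    show "(case case P of (\<sigma>, T) \<Rightarrow> (\<Union>T, T, \<sigma> - T) of (X, T, U) \<Rightarrow> ?c T * ?w U) =
        (case P of (\<sigma>, T) \<Rightarrow> ?c T * ?w (\<sigma> - T))"
      by (simp add: P)
  next
    fix P assume "P \<in> (SIGMA X:{X. s \<in> X \<and> X \<subseteq> S}. matchings_on X \<times> matchings_on (S - X))"
    then obtain X T U where P: "P = (X, T, U)" "s \<in> X" "X \<subseteq> S"
        "T \<in> matchings_on X" "U \<in> matchings_on (S - X)"
      by auto
    have "X \<union> (S - X) = S"
      using P by auto
    then have "T \<union> U \<in> matchings_on S" "T \<inter> U = {}"
      using matchings_on_Un[OF P(4,5)] by auto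
    moreover have "\<Union>T = X"
      using P matchings_on_Union by blast
    moreover have "T \<union> U - T = U"
      using \<open>T \<inter> U = {}\<close> by auto
    ultimately show "(case case P of (X, T, U) \<Rightarrow> (T \<union> U, T) of (\<sigma>, T) \<Rightarrow> (\<Union>T, T, \<sigma> - T)) = P"
      and "(case P of (X, T, U) \<Rightarrow> (T \<union> U, T)) \<in> (SIGMA \<sigma>:matchings_on S. {T. s \<in> \<Union>T \<and> T \<subseteq> \<sigma>})"
      using P by (simp_all del: Union_iff)
  qed
  also have "\<dots> = (\<Sum>X | s \<in> X \<and> X \<subseteq> S. \<Sum>(T, U)\<in>matchings_on X \<times> matchings_on (S - X). ?c T * ?w U)"
    by (rule sum.Sigma[symmetric])
      (use assms(1) in \<open>auto intro!: finite_matchings_on intro: finite_subset\<close>)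
  also have "\<dots> = (\<Sum>X | s \<in> X \<and> X \<subseteq> S. conn_matching_sum X * moment (card (S - X)))"
    unfolding conn_matching_sum_def
    by (intro sum.cong refl)
      (simp add: sum.cartesian_product[symmetric] sum_product[symmetric] sum_matchings_on assms(1))
  finally show ?thesis .
qed

text \<open>Both families solve the same rooted convolution equation, in which the term
  \<open>X = S\<close> has coefficient \<open>moment 0 = 1\<close>; by induction all other terms
  agree.\<close>

lemma conn_matching_sum_eq_cumulant:
  assumes "finite S" "S \<noteq> {}"
  shows "conn_matching_sum S = cumulant (card S)"
  using assms
proof (induction S rule: finite_psubset_induct)
  case (psubset S)
  obtain s where s: "s \<in> S"
    using psubset.prems by auto
  let ?X = "{X. s \<in> X \<and> X \<subseteq> S}"
  have "(\<Sum>X\<in>?X. conn_matching_sum X * moment (card (S - X))) =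
      (\<Sum>X\<in>?X. cumulant (card X) * moment (card (S - X)))"
    using moment_eq_sum_conn_matching_sum[OF psubset.hyps s] moment_eq_sum_subsets[OF psubset.hyps s]
    by simp
  moreover have "(\<Sum>X\<in>?X - {S}. conn_matching_sum X * moment (card (S - X))) =
      (\<Sum>X\<in>?X - {S}. cumulant (card X) * moment (card (S - X)))"
  proof (intro sum.cong refl arg_cong2[where f = "(*)"])
    fix X assume "X \<in> ?X - {S}"
    then have "X \<subset> S" "X \<noteq> {}"
      by blast+
    then show "conn_matching_sum X = cumulant (card X)"
      by (rule psubset.IH)
  qed
  moreover have "S \<in> ?X" "finite ?X"
    using psubset s by auto
  ultimately show ?case
    by (simp add: sum.remove[of ?X S] moment_0)
qed

subsection \<open>Connected matchings and connected crossing graphs\<close>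

lemma crosses_sym_cases:
  assumes "crosses a b \<or> crosses b a"
  obtains x y z where "x \<in> a" "y \<in> a" "z \<in> b" "x < z" "z < y"
  using assms unfolding crosses_def by blast

text \<open>An arch crossing one inside the interval has an end strictly between the ends of the
  latter. That end is in the interval, so the arch is itself a block of \<open>B\<close>.\<close>

lemma reach_subset_interval_blocks:
  assumes \<sigma>: "\<sigma> \<in> matchings_on S" and "B \<subseteq> \<sigma>" "\<Union>B = {i..j}" "b \<in> B"
  shows "reach (crossing_edges \<sigma>) b \<subseteq> B"
proof
  fix w assume "w \<in> reach (crossing_edges \<sigma>) b"
  then show "w \<in> B"
  proof (induction rule: reach_induct)
    case (step u w)
    then have w: "w \<in> \<sigma>" "crosses u w \<or> crosses w u"
      by (auto simp: crossing_edges_eq[of \<sigma>] crossing_edges_mem_iff)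
    from w(2) obtain x y z where xyz: "x \<in> u" "y \<in> u" "z \<in> w" "x < z" "z < y"
      by (rule crosses_sym_cases)
    have "x \<in> {i..j}" "y \<in> {i..j}"
      using xyz step assms(3) by blast+
    then have "z \<in> \<Union>B"
      using xyz unfolding assms(3) by auto
    then obtain b' where "b' \<in> B" "z \<in> b'"
      by auto
    then show ?case
      using matchings_on_disjoint[OF \<sigma>, of b' w z] w xyz assms(2) by auto
  qed (fact assms)
qed

text \<open>If no arch of the component straddled \<open>p\<close>, each would lie on one side;
  crossing arches interleave and so share a side, which would put the whole component, including
  \<open>i\<close> and \<open>j\<close>, on the same side.\<close>

lemma component_straddles:
  assumes \<sigma>: "\<sigma> \<in> matchings_on S" "d \<in> \<sigma>"
    and p: "p \<notin> \<Union>(reach (crossing_edges \<sigma>) d)"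
    and i: "i \<in> \<Union>(reach (crossing_edges \<sigma>) d)" "i < p"
    and j: "j \<in> \<Union>(reach (crossing_edges \<sigma>) d)" "p < j"
  obtains b x y where "b \<in> reach (crossing_edges \<sigma>) d" "b = {x, y}" "x < p" "p < y"
proof (rule ccontr)
  note straddle = that
  assume *: "\<not> thesis"
  let ?D = "reach (crossing_edges \<sigma>) d"
  have D: "?D \<subseteq> \<sigma>"
    using \<sigma>(2) by (intro reach_subset) (auto simp: crossing_edges_eq[of \<sigma>])
  have same_side: "x < p \<longleftrightarrow> y < p" if b: "b \<in> ?D" "x \<in> b" "y \<in> b" for b x y
  proof -
    obtain u v where uv: "b = {u, v}"
      using matchings_on_card[OF \<sigma>(1), of b] D b by (auto simp: card_2_iff)
    moreover have "u < p \<or> p < u" "v < p \<or> p < v"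
      using p b(1) uv by (auto simp: neq_iff[symmetric])
    ultimately show ?thesis
      using * straddle[OF b(1), of u v] straddle[OF b(1), of v u] b by (auto simp: insert_commute)
  qed
  obtain m where m: "m \<in> d"
    using matchings_on_card[OF \<sigma>] by (auto simp: card_2_iff)
  have "\<forall>x\<in>b. x < p \<longleftrightarrow> m < p" if "b \<in> ?D" for b
    using that
  proof (induction rule: reach_induct)
    case refl
    then show ?case
      using same_side[OF reach_refl _ m] by simp
  next
    case (step u w)
    then have w: "w \<in> ?D" "crosses u w \<or> crosses w u"
      by (auto simp: crossing_edges_eq[of \<sigma>] crossing_edges_mem_iff intro: reach_step)
    from w(2) obtain x y z where xyz: "x \<in> u" "y \<in> u" "z \<in> w" "x < z" "z < y"
      by (rule crosses_sym_cases)
    then have "z < p \<longleftrightarrow> m < p"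
      using step.IH by fastforce
    then show ?case
      using same_side[OF w(1) _ xyz(3)] by blast
  qed
  then have "i < p \<longleftrightarrow> j < p"
    using i(1) j(1) by blast
  then show False
    using i(2) j(2) by simp
qed

text \<open>An arch outside the component with an end strictly inside its span lies under an arch of the component;
  not crossing that arch, it cannot leave the span.\<close>

lemma component_span_closed:
  assumes \<sigma>: "\<sigma> \<in> matchings_on S" "d \<in> \<sigma>" and e: "e \<in> \<sigma>" "p \<in> e"
    and p: "i \<le> p" "p \<le> j"
    and i: "i \<in> \<Union>(reach (crossing_edges \<sigma>) d)" "\<And>x. x \<in> \<Union>(reach (crossing_edges \<sigma>) d) \<Longrightarrow> i \<le> x"
    and j: "j \<in> \<Union>(reach (crossing_edges \<sigma>) d)" "\<And>x. x \<in> \<Union>(reach (crossing_edges \<sigma>) d) \<Longrightarrow> x \<le> j"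
  shows "e \<subseteq> {i..j}"
proof (cases "e \<in> reach (crossing_edges \<sigma>) d")
  case True
  then have "e \<subseteq> \<Union>(reach (crossing_edges \<sigma>) d)"
    by auto
  then show ?thesis
    using i(2) j(2) by (meson atLeastAtMost_iff subsetD subsetI)
next
  case False
  let ?D = "reach (crossing_edges \<sigma>) d"
  have D: "?D \<subseteq> \<sigma>"
    using \<sigma>(2) by (intro reach_subset) (auto simp: crossing_edges_eq[of \<sigma>])
  have "p \<notin> \<Union>?D"
    using False e D matchings_on_disjoint[OF \<sigma>(1) e(1) _ e(2)] by blast
  moreover from this have "i < p" "p < j"
    using p i(1) j(1) by (metis le_neq_implies_less)+
  ultimately obtain b x y where b: "b \<in> ?D" "b = {x, y}" "x < p" "p < y"
    using component_straddles[OF \<sigma> _ i(1) _ j(1)] by metis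
  obtain z where z: "e = {p, z}" "z \<noteq> p"
    using matchings_on_card[OF \<sigma>(1) e(1)] e(2) by (auto simp: card_2_iff insert_commute)
  have "x \<in> \<Union>?D" "y \<in> \<Union>?D"
    using b(1,2) by auto
  then have xy: "i \<le> x" "y \<le> j"
    using i(2) j(2) by simp_all
  have "z \<in> {i..j}"
  proof (rule ccontr)
    assume "z \<notin> {i..j}"
    then consider "z < x" | "y < z"
      using xy by fastforce
    then have "crosses b e \<or> crosses e b"
    proof cases
      case 1
      then show ?thesis
        using crosses_iff[of z p x y] b z by (simp add: insert_commute)
    next
      case 2
      then show ?thesis
        using crosses_iff[of x y p z] b z by simp
    qed
    then have "{b, e} \<in> crossing_edges \<sigma>"
      using b(1) D e(1) by (auto simp: crossing_edges_eq[of \<sigma>] crossing_edges_mem_iff)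
    then show False
      using False reach_step[OF b(1)] by simp
  qed
  then show ?thesis
    using z p by simp
qed

text \<open>Blocks filling a proper interval are closed under crossing, hence disconnect the graph.
  Conversely the span of a component is filled by blocks, and choosing a component that misses the
  point 1 makes this interval proper. For \<open>n = 0\<close> the empty matching is connected but
  has no component.\<close>

lemma connected_matchings_iff:
  assumes "n \<ge> 1"
  shows "\<sigma> \<in> connected_matchings n \<longleftrightarrow>
    \<sigma> \<in> matchings n \<and> card (components \<sigma> (crossing_edges \<sigma>)) = 1"
proof (cases "\<sigma> \<in> matchings n")
  case True
  then have \<sigma>: "\<sigma> \<in> matchings_on {1..2 * n}"
    by (simp add: matchings_eq)
  have E: "crossing_edges \<sigma> \<subseteq> Pow \<sigma>"
    by (auto simp: crossing_edges_eq[of \<sigma>])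
  have U: "\<Union>\<sigma> = {1..2 * n}"
    by (rule matchings_on_Union[OF \<sigma>])
  let ?reach = "reach (crossing_edges \<sigma>)"
  have "(\<exists>i j. 1 \<le> i \<and> i \<le> j \<and> j \<le> 2 * n \<and> {i..j} \<noteq> {1..2 * n} \<and> (\<exists>B\<subseteq>\<sigma>. \<Union>B = {i..j})) \<longleftrightarrow>
      card (components \<sigma> (crossing_edges \<sigma>)) \<noteq> 1" (is "?L \<longleftrightarrow> ?R")
  proof
    assume ?L
    then obtain i j B where *: "i \<le> j" "{i..j} \<noteq> {1..2 * n}" "B \<subseteq> \<sigma>" "\<Union>B = {i..j}"
      by blast
    then obtain b where b: "b \<in> B"
      by (metis Union_empty atLeastatMost_empty_iff2 ex_in_conv not_le)
    have "?reach b \<noteq> \<sigma>"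
      using reach_subset_interval_blocks[OF \<sigma> *(3,4) b] * U by auto
    then show ?R
      using card_components_eq_1_iff[OF E] b *(3) by blast
  next
    assume ?R
    have "1 \<in> \<Union>\<sigma>"
      using assms unfolding U by simp
    then obtain b1 where b1: "b1 \<in> \<sigma>" "1 \<in> b1"
      by auto
    then have "?reach b1 \<noteq> \<sigma>"
      using \<open>?R\<close> card_components_eq_1_iff[OF E] by blast
    then obtain d where d: "d \<in> \<sigma>" "d \<notin> ?reach b1"
      using reach_subset[OF E b1(1)] by blast
    let ?D = "\<Union>(?reach d)"
    have D: "?reach d \<subseteq> \<sigma>"
      by (rule reach_subset[OF E d(1)])
    then have D': "?D \<subseteq> {1..2 * n}"
      using U by blast
    have "1 \<notin> ?D"
    proof
      assume "1 \<in> ?D"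
      then obtain b where "b \<in> ?reach d" "1 \<in> b"
        by auto
      then have "b1 \<in> ?reach d"
        using matchings_on_disjoint[OF \<sigma> _ b1(1) _ b1(2), of b] D by auto
      then show False
        using d(2) reach_commute by metis
    qed
    have fin: "finite ?D"
      using D' by (rule finite_subset) simp
    have "d \<noteq> {}"
      using matchings_on_card[OF \<sigma> d(1)] by auto
    then have ne: "?D \<noteq> {}"
      using reach_refl[of d "crossing_edges \<sigma>"] by blast
    define i where "i = Min ?D"
    define j where "j = Max ?D"
    have i: "i \<in> ?D" "\<And>x. x \<in> ?D \<Longrightarrow> i \<le> x"
      unfolding i_def using fin ne by (auto simp del: Union_iff)
    have j: "j \<in> ?D" "\<And>x. x \<in> ?D \<Longrightarrow> x \<le> j"
      unfolding j_def using fin ne by (auto simp del: Union_iff)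
    have ij: "1 \<le> i" "i \<le> j" "j \<le> 2 * n" "i \<noteq> 1"
      using i j D' \<open>1 \<notin> ?D\<close> by (auto simp del: Union_iff)
    \<comment> \<open>Arches nested under the component must be taken along to fill the
      span.\<close>
    let ?B = "{b \<in> \<sigma>. b \<inter> {i..j} \<noteq> {}}"
    have sub: "b \<subseteq> {i..j}" if b: "b \<in> ?B" for b
    proof -
      obtain p where "p \<in> b" "i \<le> p" "p \<le> j"
        using b by auto
      then show ?thesis
        using component_span_closed[OF \<sigma> d(1) _ _ _ _ i j] b by blast
    qed
    have "\<Union>?B = {i..j}"
    proof (intro equalityI subsetI)
      fix x assume x: "x \<in> {i..j}"
      then have "x \<in> \<Union>\<sigma>"
        unfolding U using ij by simp
      then obtain b where "b \<in> \<sigma>" "x \<in> b"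
        by (rule UnionE)
      moreover from this x have "b \<in> ?B"
        by auto
      ultimately show "x \<in> \<Union>?B"
        by (intro UnionI)
    next
      fix x assume "x \<in> \<Union>?B"
      then obtain b where "b \<in> ?B" "x \<in> b"
        by (rule UnionE)
      then show "x \<in> {i..j}"
        using sub by (meson subsetD)
    qed
    moreover have "{i..j} \<noteq> {1..2 * n}"
      using ij assms by (simp add: Icc_eq_Icc)
    ultimately show ?L
      using ij by (intro exI[of _ i] exI[of _ j] conjI exI[of _ ?B]) auto
  qed
  then show ?thesis
    using True unfolding connected_matchings_def mem_Collect_eq by argo
qed (simp add: connected_matchings_def)

subsection \<open>The Tutte polynomial at \<open>x = 1\<close>\<close>

lemma conn_sum_eq_0:
  assumes "v \<in> V" "card (components V (E \<inter> Pow V)) \<noteq> 1"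
  shows "conn_sum t E V = 0"
proof -
  have "card (components V A) \<noteq> 1" if A: "A \<subseteq> E \<inter> Pow V" for A
  proof -
    have "A \<subseteq> Pow V"
      using A by blast
    moreover have "reach (E \<inter> Pow V) v \<subseteq> V" "reach (E \<inter> Pow V) v \<noteq> V"
      using reach_subset[of "E \<inter> Pow V" V v] card_components_eq_1_iff[of "E \<inter> Pow V" V v] assms by auto
    ultimately show ?thesis
      using reach_mono[OF A, of v] card_components_eq_1_iff[of A V v] assms(1) by auto
  qed
  then have "{A. A \<subseteq> E \<inter> Pow V \<and> card (components V A) = 1} = {}"
    by blast
  then show ?thesis
    unfolding conn_sum_def by (simp only: sum.empty)
qed

text \<open>At \<open>x = 1\<close> the convention \<open>0 ^ 0 = 1\<close> keeps exactly the
  connected \<open>A\<close>, with exponent \<open>1 + card A - card V\<close>; the prefactor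
  completes it to \<open>card A\<close>.\<close>

lemma conn_sum_eq_tutte:
  fixes y :: "'a::comm_ring_1"
  assumes "finite V" "v \<in> V" and conn: "card (components V (E \<inter> Pow V)) = 1"
  shows "conn_sum (y - 1) E V = (y - 1) ^ (card V - 1) * tutte V (E \<inter> Pow V) 1 y"
proof -
  have "card V > 0"
    using assms(1,2) by (auto simp: card_gt_0_iff)
  have summand: "(y - 1) ^ (card V - 1) * ((1 - 1) ^ (card (components V A) - card (components V (E \<inter> Pow V))) *
      (y - 1) ^ (card (components V A) + card A - card V)) =
      (if card (components V A) = 1 then (y - 1) ^ card A else 0)" if A: "A \<subseteq> E \<inter> Pow V" for A
  proof (cases "card (components V A) = 1")
    case True
    have "finite A"
      using A assms(1) by (meson finite_Int finite_Pow_iff finite_subset)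
    moreover have "reach A v = V"
      using True card_components_eq_1_iff[of A V v] A assms(2) by auto
    ultimately have "card V \<le> card A + 1"
      using card_le_edges_connected assms(1,2) by metis
    then show ?thesis
      using True conn \<open>card V > 0\<close> by (simp flip: power_add)
  next
    case False
    have "components V A = reach A ` V"
      using A by (intro components_eq_reach) auto
    \<comment> \<open>A positive count other than 1 exceeds 1, so the power of \<open>1 - 1\<close>
      vanishes.\<close>
    then have "card (components V A) > 0"
      using assms(1,2) by (auto simp: card_gt_0_iff)
    then show ?thesis
      using False conn by (simp add: power_0_left)
  qed
  have "(y - 1) ^ (card V - 1) * tutte V (E \<inter> Pow V) 1 y =
      (\<Sum>A\<in>Pow (E \<inter> Pow V). if card (components V A) = 1 then (y - 1) ^ card A else 0)"
    unfolding tutte_def sum_distrib_left by (intro sum.cong refl summand) simp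
  also have "\<dots> = (\<Sum>A | A \<in> Pow (E \<inter> Pow V) \<and> card (components V A) = 1. (y - 1) ^ card A)"
    using assms(1) by (subst sum.inter_filter) simp_all
  finally show ?thesis
    by (simp add: conn_sum_def)
qed

lemma card_matching: "\<sigma> \<in> matchings n \<Longrightarrow> card \<sigma> = n"
proof -
  assume "\<sigma> \<in> matchings n"
  then have \<sigma>: "\<sigma> \<in> matchings_on {1..2 * n}"
    by (simp add: matchings_eq)
  have "card (\<Union>\<sigma>) = (\<Sum>b\<in>\<sigma>. card b)"
    using \<sigma> by (intro card_Union_disjoint)
      (auto simp: matchings_on_def partition_on_def disjoint_def pairwise_def disjnt_def intro: card_ge_0_finite)
  also have "\<dots> = 2 * card \<sigma>"
    using matchings_on_card[OF \<sigma>] by simp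
  finally show ?thesis
    using matchings_on_Union[OF \<sigma>] by simp
qed

theorem theorem3p4:
  fixes n :: nat
  assumes "n \<ge> 1"
  shows "ktilde n = (\<Sum>\<sigma>\<in>connected_matchings n. tutte \<sigma> (crossing_edges \<sigma>) 1 q) \<and>
         (\<exists>p :: int poly. (\<forall>i. coeff p i \<ge> 0) \<and> ktilde n = poly (map_poly of_int p) q)"
proof -
  let ?c = "conn_sum (q - 1) (crossing_edges UNIV)"
  have q: "q - 1 \<noteq> 0"
    using q_neq_1 by simp
  have fin: "finite \<sigma>" "\<sigma> \<noteq> {}" if "\<sigma> \<in> matchings n" for \<sigma>
    using card_matching[OF that] assms by (auto intro: card_ge_0_finite)
  have c: "?c \<sigma> = (q - 1) ^ (n - 1) * tutte \<sigma> (crossing_edges \<sigma>) 1 q" if "\<sigma> \<in> connected_matchings n" for \<sigma>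
  proof -
    have \<sigma>: "\<sigma> \<in> matchings n" "card (components \<sigma> (crossing_edges \<sigma>)) = 1"
      using that connected_matchings_iff[OF assms] by auto
    then obtain v where "v \<in> \<sigma>"
      using fin by auto
    then show ?thesis
      using conn_sum_eq_tutte[OF fin(1)[OF \<sigma>(1)], of v "crossing_edges UNIV" q] \<sigma>
      by (simp add: card_matching flip: crossing_edges_eq)
  qed
  have "cumulant (2 * n) = conn_matching_sum {1..2 * n}"
    using assms by (subst conn_matching_sum_eq_cumulant) auto
  also have "\<dots> = sum ?c (matchings n)"
    by (simp add: conn_matching_sum_def matchings_eq)
  also have "\<dots> = sum ?c (connected_matchings n)"
  proof (rule sum.mono_neutral_right)
    show "finite (matchings n)"
      unfolding matchings_eq by (rule finite_matchings_on) simp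
    show "connected_matchings n \<subseteq> matchings n"
      by (auto simp: connected_matchings_def)
    show "\<forall>\<sigma>\<in>matchings n - connected_matchings n. ?c \<sigma> = 0"
    proof
      fix \<sigma> assume \<sigma>: "\<sigma> \<in> matchings n - connected_matchings n"
      then obtain v where "v \<in> \<sigma>"
        using fin by auto
      then show "?c \<sigma> = 0"
        using \<sigma> connected_matchings_iff[OF assms, of \<sigma>]
        by (intro conn_sum_eq_0) (auto simp flip: crossing_edges_eq)
    qed
  qed
  also have "\<dots> = (q - 1) ^ (n - 1) * (\<Sum>\<sigma>\<in>connected_matchings n. tutte \<sigma> (crossing_edges \<sigma>) 1 q)"
    using c by (simp add: sum_distrib_left)
  finally have eq: "ktilde n = (\<Sum>\<sigma>\<in>connected_matchings n. tutte \<sigma> (crossing_edges \<sigma>) 1 q)"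
    using q by (simp add: ktilde_def)
  have "tutte \<sigma> (crossing_edges \<sigma>) 1 q \<in> nonneg_poly_values q" if "\<sigma> \<in> connected_matchings n" for \<sigma>
  proof -
    have \<sigma>: "\<sigma> \<in> matchings n"
      using that by (simp add: connected_matchings_def)
    obtain P where P: "P \<in> nonneg_poly_values q" "?c \<sigma> = (q - 1) ^ (card \<sigma> - 1) * P"
      using conn_sum_eq_power_times_nonneg_poly[OF fin[OF \<sigma>] card_crossing_edge] by blast
    \<comment> \<open>Cancelling \<open>(q - 1) ^ (n - 1)\<close> in the field of rational functions
      passes positivity from \<open>?c\<close> to the Tutte value.\<close>
    then have "tutte \<sigma> (crossing_edges \<sigma>) 1 q = P"
      using c[OF that] q by (simp add: card_matching[OF \<sigma>])
    then show ?thesis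
      using P by simp
  qed
  then have "ktilde n \<in> nonneg_poly_values q"
    unfolding eq by (rule nonneg_poly_values_sum)
  then show ?thesis
    using eq by (auto simp: nonneg_poly_values_def)
qed

end
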